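(* Let $m(n)$ be an increasing (integer-valued) function of $n$ tending to infinity. Assume that (i) there exists $(n_1,\dots,n_p)\in(\mathbb{N}\setminus\{0\})^p$ such that $\mathbb{P}(|f(G,(n_1,\dots,n_p))|>0)>0$; (ii) there exists $\gamma>0$ such that $\mathbb{E}[|f(G,N^\mu)|^{2+\gamma}]<\infty$; (iii) there exists $\delta>0$ such that $\mathbb{E}[|f(G,N^\mu)|^{4+\delta}]<\infty$. Then $M^{A,B}_{n,m(n)}$ converges almost surely to $\mathbb{E}[f(G,N^\mu)]$ as $n$ goes to infinity.
   Context: $\mathbb{N}=\{0,1,2,\dots\}$. $G$ is a standard normal random vector in $\mathbb{R}^d$; $\mu\in(0,\infty)^p$ is fixed; $N^\mu=(N_1^{\mu_1},\dots,N_p^{\mu_p})$ is a vector of independent Poisson random variables with parameters $\mu_1,\dots,\mu_p$, independent of $G$. $f:\mathbb{R}^d\times\mathbb{N}^p\to\mathbb{R}$ is measurable with $\mathbb{E}[|f(G,N^\mu)|]<\infty$. For $g,\theta\in\mathbb{R}^d$, $n\in\mathbb{N}^p$, $\lambda\in(0,\infty)^p$, $$F(g,\theta,n,\lambda)=f(g,n)^2\,e^{-\theta\cdot g+\frac{|\theta|^2}{2}}\prod_{i=1}^p e^{\lambda_i-\mu_i}\left(\frac{\mu_i}{\lambda_i}\right)^{n_i}.$$ Let $0<d'\le d$, $0<p'\le p$, let $A\in\mathbb{R}^{d\times d'}$ have rank $d'$, and let $B\in\mathbb{R}^{p\times p'}$ have rank $p'$, nonnegative entries, and map $(0,\infty)^{p'}$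 into $(0,\infty)^p$. First stage: let $(G^j,N^{\mu,j})_{j\ge1}$ be i.i.d. copies of $(G,N^\mu)$ and, for $m\ge1$ and $(\vartheta,\ell)\in\mathbb{R}^{d'}\times(0,\infty)^{p'}$, $$v_m^{A,B}(\vartheta,\ell)=\frac1m\sum_{j=1}^mF(G^j,A\vartheta,N^{\mu,j},B\ell).$$ The function $v_m^{A,B}$ is strongly convex for $m$ large enough (once $f(G^j,N^{\mu,j})\neq0$ for some $j\le m$), and $(\vartheta_m,\ell_m)$ denotes its unique minimizer, $$(\vartheta_m,\ell_m)=\arg\min_{(\vartheta,\ell)\in\mathbb{R}^{d'}\times(0,\infty)^{p'}}v_m^{A,B}(\vartheta,\ell).$$ Second stage: for given $n,m$, let $(\bar G^j,\bar N^j)_{1\le j\le n}$ be such that, conditionally on the first-stage samples $(G^j,N^{\mu,j})_{j\ge1}$, the pairs are i.i.d., $\bar G^j$ is standard normal in $\mathbb{R}^d$, $\bar N^j=(\bar N^j_1,\dots,\bar N^j_p)$ is a vector of independent Poisson random variables with parameters $(B\ell_m)_1,\dots,(B\ell_m)_p$, and $\bar G^j$ and $\bar N^j$ are independent ($\bar N^j$ depends on $m$). Define $$M^{A,B}_{n,m}=\frac1n\sum_{j=1}^nf(\bar G^j+A\vartheta_m,\bar N^j)\,e^{-A\vartheta_m\cdot\bar G^j-\frac{|A\vartheta_m|^2}{2}}\prod_{i=1}^pe^{(B\ell_m)_i-\mu_i}\left(\frac{\mu_i}{(B\ell_m)_i}\right)^{\bar N_i^j}.$$ *)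

theory Defs
  imports "HOL-Probability.Probability"
begin

text \<open>
  The vectors of \<open>\<real>\<^sup>d\<close> and \<open>\<nat>\<^sup>p\<close> are rendered as \<^typ>\<open>real ^ 'd\<close> and \<^typ>\<open>nat ^ 'p\<close>.
  The Euclidean factor carries its Borel sets, the countable factor all of its subsets.
\<close>

abbreviation sample_space :: "((real ^ 'd) \<times> (nat ^ 'p)) measure" where
  "sample_space \<equiv> borel \<Otimes>\<^sub>M count_space UNIV"

definition std_normal_vec :: "(real ^ 'd) measure" where
  "std_normal_vec = density lborel (\<lambda>x. ennreal (\<Prod>i\<in>UNIV. std_normal_density (x $ i)))"

text \<open>
  Independent Poisson coordinates. The rates have to be positive: outside of this range
  \<^const>\<open>poisson_pmf\<close> is unspecified.
\<close>

definition poisson_vec :: "real ^ 'p \<Rightarrow> (nat ^ 'p) pmf" where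
  "poisson_vec rate = map_pmf vec_lambda (Pi_pmf UNIV 0 (\<lambda>i. poisson_pmf (rate $ i)))"

text \<open>
  The joint law of a standard normal vector and an independent vector of independent
  Poisson variables.
\<close>

definition normal_poisson :: "real ^ 'p \<Rightarrow> ((real ^ 'd) \<times> (nat ^ 'p)) measure" where
  "normal_poisson rate = std_normal_vec \<Otimes>\<^sub>M measure_pmf (poisson_vec rate)"

definition is_normal_poisson ::
  "'w measure \<Rightarrow> real ^ 'p \<Rightarrow> ('w \<Rightarrow> real ^ 'd) \<Rightarrow> ('w \<Rightarrow> nat ^ 'p) \<Rightarrow> bool" where
  "is_normal_poisson M rate G N \<longleftrightarrow>
     (\<lambda>\<omega>. (G \<omega>, N \<omega>)) \<in> M \<rightarrow>\<^sub>M sample_space \<and>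
     distr M sample_space (\<lambda>\<omega>. (G \<omega>, N \<omega>)) = normal_poisson rate"

definition pos_vec :: "real ^ 'n \<Rightarrow> bool" where
  "pos_vec x \<longleftrightarrow> (\<forall>i. 0 < x $ i)"

text \<open>The function \<open>F(g,\<theta>,n,\<lambda>)\<close>, with \<open>f\<close> and \<open>\<mu>\<close> as explicit parameters.\<close>

definition F_fun ::
  "((real ^ 'd) \<times> (nat ^ 'p) \<Rightarrow> real) \<Rightarrow> real ^ 'p \<Rightarrow>
   real ^ 'd \<Rightarrow> real ^ 'd \<Rightarrow> nat ^ 'p \<Rightarrow> real ^ 'p \<Rightarrow> real" where
  "F_fun f \<mu> g \<theta> n l =
     (f (g, n))\<^sup>2 * exp (- (\<theta> \<bullet> g) + (norm \<theta>)\<^sup>2 / 2) *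
     (\<Prod>i\<in>UNIV. exp (l $ i - \<mu> $ i) * (\<mu> $ i / l $ i) ^ (n $ i))"

text \<open>
  In the following \<open>s j = (g\<^sub>j, n\<^sub>j)\<close>, \<open>j \<ge> 1\<close>, is a realization of the first-stage sample.
\<close>

definition v_fun ::
  "((real ^ 'd) \<times> (nat ^ 'p) \<Rightarrow> real) \<Rightarrow> real ^ 'p \<Rightarrow> real ^ 'e ^ 'd \<Rightarrow> real ^ 'q ^ 'p \<Rightarrow>
   (nat \<Rightarrow> (real ^ 'd) \<times> (nat ^ 'p)) \<Rightarrow> nat \<Rightarrow> (real ^ 'e) \<times> (real ^ 'q) \<Rightarrow> real" where
  "v_fun f \<mu> A B s m = (\<lambda>(\<theta>, l).
     (1 / real m) * (\<Sum>j=1..m. F_fun f \<mu> (fst (s j)) (A *v \<theta>) (snd (s j)) (B *v l)))"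

definition admissible :: "(real ^ 'e) \<times> (real ^ 'q) \<Rightarrow> bool" where
  "admissible x \<longleftrightarrow> pos_vec (snd x)"

text \<open>
  The minimizer \<open>(\<vartheta>\<^sub>m, \<ell>\<^sub>m)\<close>. The infimum over the open set of admissible points need not be
  attained: either because the sample contains no point with \<open>f \<noteq> 0\<close> and positive counts, or
  because \<open>\<ell>\<close> can approach the boundary of the positive orthant while \<open>B\<ell>\<close> stays inside the
  positive orthant. An admissible point \<open>x0\<close> is the conventional value whenever there is no
  unique minimizer.
\<close>

definition minimizer ::
  "((real ^ 'd) \<times> (nat ^ 'p) \<Rightarrow> real) \<Rightarrow> real ^ 'p \<Rightarrow> real ^ 'e ^ 'd \<Rightarrow> real ^ 'q ^ 'p \<Rightarrow>
   (real ^ 'e) \<times> (real ^ 'q) \<Rightarrow>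
   (nat \<Rightarrow> (real ^ 'd) \<times> (nat ^ 'p)) \<Rightarrow> nat \<Rightarrow> (real ^ 'e) \<times> (real ^ 'q)" where
  "minimizer f \<mu> A B x0 s m =
     (if \<exists>!x. is_arg_min (v_fun f \<mu> A B s m) admissible x
      then arg_min (v_fun f \<mu> A B s m) admissible else x0)"

definition theta_min ::
  "((real ^ 'd) \<times> (nat ^ 'p) \<Rightarrow> real) \<Rightarrow> real ^ 'p \<Rightarrow> real ^ 'e ^ 'd \<Rightarrow> real ^ 'q ^ 'p \<Rightarrow>
   (real ^ 'e) \<times> (real ^ 'q) \<Rightarrow>
   (nat \<Rightarrow> (real ^ 'd) \<times> (nat ^ 'p)) \<Rightarrow> nat \<Rightarrow> real ^ 'e" where
  "theta_min f \<mu> A B x0 s m = fst (minimizer f \<mu> A B x0 s m)"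

definition ell_min ::
  "((real ^ 'd) \<times> (nat ^ 'p) \<Rightarrow> real) \<Rightarrow> real ^ 'p \<Rightarrow> real ^ 'e ^ 'd \<Rightarrow> real ^ 'q ^ 'p \<Rightarrow>
   (real ^ 'e) \<times> (real ^ 'q) \<Rightarrow>
   (nat \<Rightarrow> (real ^ 'd) \<times> (nat ^ 'p)) \<Rightarrow> nat \<Rightarrow> real ^ 'q" where
  "ell_min f \<mu> A B x0 s m = snd (minimizer f \<mu> A B x0 s m)"

text \<open>
  The importance sampling estimator: \<open>t j = (g\<^sub>j, n\<^sub>j)\<close>, \<open>1 \<le> j \<le> n\<close>, is the second-stage
  sample, \<open>\<theta>\<close> and \<open>l\<close> stand for \<open>A\<vartheta>\<^sub>m\<close> and \<open>B\<ell>\<^sub>m\<close>.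
\<close>

definition importance_estimator ::
  "((real ^ 'd) \<times> (nat ^ 'p) \<Rightarrow> real) \<Rightarrow> real ^ 'p \<Rightarrow> real ^ 'd \<Rightarrow> real ^ 'p \<Rightarrow>
   nat \<Rightarrow> (nat \<Rightarrow> (real ^ 'd) \<times> (nat ^ 'p)) \<Rightarrow> real" where
  "importance_estimator f \<mu> \<theta> l n t =
     (1 / real n) * (\<Sum>j=1..n. f (fst (t j) + \<theta>, snd (t j)) *
        exp (- (\<theta> \<bullet> fst (t j)) - (norm \<theta>)\<^sup>2 / 2) *
        (\<Prod>i\<in>UNIV. exp (l $ i - \<mu> $ i) * (\<mu> $ i / l $ i) ^ (snd (t j) $ i)))"

definition M_est ::
  "((real ^ 'd) \<times> (nat ^ 'p) \<Rightarrow> real) \<Rightarrow> real ^ 'p \<Rightarrow> real ^ 'e ^ 'd \<Rightarrow> real ^ 'q ^ 'p \<Rightarrow>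
   (real ^ 'e) \<times> (real ^ 'q) \<Rightarrow>
   (nat \<Rightarrow> (real ^ 'd) \<times> (nat ^ 'p)) \<Rightarrow> (nat \<Rightarrow> (real ^ 'd) \<times> (nat ^ 'p)) \<Rightarrow> nat \<Rightarrow> nat \<Rightarrow> real" where
  "M_est f \<mu> A B x0 s t n m =
     importance_estimator f \<mu> (A *v theta_min f \<mu> A B x0 s m) (B *v ell_min f \<mu> A B x0 s m) n t"

definition first_stage_algebra ::
  "'w measure \<Rightarrow> (nat \<Rightarrow> 'w \<Rightarrow> (real ^ 'd) \<times> (nat ^ 'p)) \<Rightarrow> 'w measure" where
  "first_stage_algebra M X =
     vimage_algebra (space M) (\<lambda>\<omega>. \<lambda>j\<in>{1..}. X j \<omega>) (PiM {1..} (\<lambda>_. sample_space))"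

text \<open>
  The conditional law of the \<open>S\<close>-valued random variable \<open>Y\<close> given the \<open>\<sigma>\<close>-algebra \<open>H\<close> is the
  random measure \<open>K\<close>.
\<close>

definition has_cond_law ::
  "'w measure \<Rightarrow> 'w measure \<Rightarrow> 'b measure \<Rightarrow> ('w \<Rightarrow> 'b) \<Rightarrow> ('w \<Rightarrow> 'b measure) \<Rightarrow> bool"
  where
  "has_cond_law M H S Y K \<longleftrightarrow>
     Y \<in> M \<rightarrow>\<^sub>M S \<and>
     (\<forall>T\<in>sets S. AE \<omega> in M.
        real_cond_exp M H (indicator (Y -` T \<inter> space M)) \<omega> = measure (K \<omega>) T)"

end

theory Submission
  imports Defs
begin

text \<open>
  Write \<open>P\<close> for the law of \<open>(G, N\<^sup>\<mu>)\<close>. A shift \<open>\<theta>\<close> of the normal component together with Poisson rates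
  \<open>\<lambda>\<close> turns \<open>P\<close> into the law \<open>L\<^sub>z P\<close>, where \<open>L\<^sub>z\<close>, called \<open>tilt\<close> below, is the exponential of a linear
  function of the point, with parameter \<open>z = (\<theta>, ln (\<lambda> / \<mu>))\<close>, up to normalization
  (\<open>normal_poisson_tilt\<close>). In these terms the first stage minimizes the average of \<open>f\<^sup>2 / L\<^sub>z\<close> under \<open>P\<close>, and
  the second stage averages \<open>f / L\<^sub>z\<close> over \<open>n\<close> independent points with law \<open>L\<^sub>z P\<close>, where \<open>z\<close> is the
  parameter \<open>z\<^sub>m\<close> of the minimizer.

  Given the first stage, a summand of the second stage has mean \<open>E f\<close>, whatever \<open>z\<close> is, and fourth
  moment \<open>E (f\<^sup>4 L\<^sub>z\<^sup>-\<^sup>3)\<close>. Negative powers of \<open>L\<^sub>z\<close> are multiples of members of the same family, hence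
  have explicit integrals, and Young's inequality with the moment of order \<open>4 + \<delta>\<close> of \<open>f\<close> bounds the
  fourth moment by a continuous function of \<open>z\<close> (\<open>integral_power4_tilt\<close>). So a deviation of the
  estimator by \<open>e\<close> while \<open>\<parallel>z\<^sub>m\<parallel> \<le> R\<close> has probability at most \<open>C / (e\<^sup>4 n\<^sup>2)\<close> with \<open>C\<close> independent of \<open>m\<close>
  (\<open>second_stage_tail_bound\<close>). Nothing is known about the joint law of the second stages for
  different \<open>n\<close>; this is why the power \<open>n\<^sup>-\<^sup>2\<close>, and thus the fourth moment, is wanted: the bounds are
  summable and the Borel--Cantelli lemma applies.

  It remains to bound \<open>z\<^sub>m\<close> almost surely (\<open>minimizer_eventually_bounded\<close>). The minimal value does not
  exceed the value at a fixed admissible point, which is an average of independent square integrable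
  terms. On the other hand, a positive fraction of the first stage sample has the positive counts
  \<open>n0\<close>, a bounded normal component and \<open>|f|\<close> bounded away from zero; there \<open>1 / L\<^sub>z\<close> is at least
  \<open>\<parallel>z\<parallel> - C\<close> (\<open>inverse_tilt_coercive\<close>), so that the function minimized exceeds any given bound outside a
  large ball.

  Conditioning on the first stage amounts to freezing \<open>z\<^sub>m\<close> (\<open>joint_law_of_cond_law\<close>), which requires
  the minimizer to be a measurable function of the first stage sample (\<open>measurable_unique_arg_min\<close>).
\<close>

section \<open>The exponential family of a normal and a Poisson vector\<close>

text \<open>
  The parameter \<open>z = (\<theta>, \<eta>)\<close> is the natural parameter of the exponential family generated by the
  law of \<open>(G, N\<^sup>\<mu>)\<close>; a vector \<open>\<lambda>\<close> of Poisson rates corresponds to \<open>\<eta>\<^sub>i = ln (\<lambda>\<^sub>i / \<mu>\<^sub>i)\<close>. In this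
  parameter the likelihood ratio is the exponential of a linear function, the admissible set of
  rates becomes a whole space, and its relatively compact subsets are the bounded sets.
  The function \<open>cumulant\<close> is the logarithm of the moment generating function of that law.
\<close>

definition cumulant :: "real ^ 'p \<Rightarrow> (real ^ 'd) \<times> (real ^ 'p) \<Rightarrow> real" where
  "cumulant \<mu> z = (norm (fst z))\<^sup>2 / 2 + (\<Sum>i\<in>UNIV. \<mu> $ i * (exp (snd z $ i) - 1))"

definition pairing :: "(real ^ 'd) \<times> (real ^ 'p) \<Rightarrow> (real ^ 'd) \<times> (nat ^ 'p) \<Rightarrow> real" where
  "pairing z y = fst z \<bullet> fst y + (\<Sum>i\<in>UNIV. real (snd y $ i) * snd z $ i)"

definition tilt :: "real ^ 'p \<Rightarrow> (real ^ 'd) \<times> (real ^ 'p) \<Rightarrow> (real ^ 'd) \<times> (nat ^ 'p) \<Rightarrow> real" where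
  "tilt \<mu> z y = exp (pairing z y - cumulant \<mu> z)"

definition tilted_rate :: "real ^ 'p \<Rightarrow> real ^ 'p \<Rightarrow> real ^ 'p" where
  "tilted_rate \<mu> \<eta> = (\<chi> i. \<mu> $ i * exp (\<eta> $ i))"

lemma pos_vec_tilted_rate: "pos_vec \<mu> \<Longrightarrow> pos_vec (tilted_rate \<mu> \<eta>)"
  by (simp add: pos_vec_def tilted_rate_def)

lemma tilt_pos: "0 < tilt \<mu> z y"
  by (simp add: tilt_def)

lemma measurable_vec_nth_count_space [measurable]:
  "(\<lambda>n :: nat ^ 'p. real (n $ i)) \<in> borel_measurable (count_space UNIV)"
  by simp

lemma borel_measurable_pairing [measurable]:
  "(\<lambda>(z, y). pairing z y) \<in> borel_measurable ((borel :: ((real ^ 'd) \<times> (real ^ 'p)) measure) \<Otimes>\<^sub>M sample_space)"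
proof -
  have [measurable]: "(\<lambda>z :: (real ^ 'd) \<times> (real ^ 'p). snd z $ i) \<in> borel_measurable borel" for i
    by (intro borel_measurable_continuous_onI continuous_intros)
  have [measurable]: "(\<lambda>z :: (real ^ 'd) \<times> (real ^ 'p). fst z) \<in> borel_measurable borel"
    by (intro borel_measurable_continuous_onI continuous_intros)
  have [measurable]: "(\<lambda>x. real (snd (snd x) $ i)) \<in> borel_measurable
      ((borel :: ((real ^ 'd) \<times> (real ^ 'p)) measure) \<Otimes>\<^sub>M (sample_space :: ((real ^ 'd) \<times> (nat ^ 'p)) measure))" for i
    by (rule measurable_compose[OF _ measurable_vec_nth_count_space]) measurable
  show ?thesis
    unfolding pairing_def case_prod_beta by measurable
qed

lemma borel_measurable_pairing_right [measurable]:
  "pairing z \<in> borel_measurable sample_space"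
proof -
  have "(\<lambda>y. (z, y)) \<in> sample_space \<rightarrow>\<^sub>M borel \<Otimes>\<^sub>M sample_space" by measurable
  from measurable_compose[OF this borel_measurable_pairing] show ?thesis by simp
qed

lemma continuous_on_cumulant: "continuous_on UNIV (cumulant \<mu>)"
  unfolding cumulant_def by (intro continuous_intros) simp

lemma borel_measurable_cumulant [measurable]: "cumulant \<mu> \<in> borel_measurable borel"
  by (intro borel_measurable_continuous_onI continuous_on_cumulant)

lemma borel_measurable_tilt [measurable]:
  "(\<lambda>(z, y). tilt \<mu> z y) \<in> borel_measurable (borel \<Otimes>\<^sub>M sample_space)"
  unfolding tilt_def case_prod_beta
  using borel_measurable_pairing by (auto simp: case_prod_beta)

lemma borel_measurable_tilt_right [measurable]: "tilt \<mu> z \<in> borel_measurable sample_space"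
  unfolding tilt_def by measurable

lemma sets_std_normal_vec [simp, measurable_cong]: "sets std_normal_vec = sets borel"
  by (simp add: std_normal_vec_def)

lemma space_std_normal_vec [simp]: "space std_normal_vec = UNIV"
  by (simp add: std_normal_vec_def)

lemma sets_normal_poisson [simp, measurable_cong]:
  "sets (normal_poisson rate) = sets sample_space"
  unfolding normal_poisson_def by (intro sets_pair_measure_cong) simp_all

lemma space_normal_poisson [simp]: "space (normal_poisson rate) = UNIV"
  by (simp add: normal_poisson_def space_pair_measure)

lemma prob_space_std_normal_vec: "prob_space (std_normal_vec :: (real ^ 'd) measure)"
proof
  have *: "(\<Prod>i\<in>UNIV. std_normal_density (x $ i)) = (\<Prod>b\<in>Basis. std_normal_density (x \<bullet> b))"
    for x :: "real ^ 'd"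
    by (simp add: Basis_vec_def axis_inverse inner_axis
        prod.UNION_disjoint axis_eq_axis)
  have "emeasure (std_normal_vec :: (real ^ 'd) measure) UNIV =
      (\<integral>\<^sup>+x. (\<Prod>b\<in>Basis. ennreal (std_normal_density (x \<bullet> b))) \<partial>(lborel :: (real ^ 'd) measure))"
    unfolding std_normal_vec_def
    by (subst emeasure_density) (auto simp: * prod_ennreal)
  also have "\<dots> = (\<Prod>b\<in>(Basis :: (real ^ 'd) set). (\<integral>\<^sup>+x. ennreal (std_normal_density x) \<partial>lborel))"
    by (subst nn_integral_lborel_prod) auto
  also have "(\<integral>\<^sup>+x. ennreal (std_normal_density x) \<partial>lborel) = 1"
    using prob_space.emeasure_space_1[OF prob_space_normal_density[of 1 0]]
    by (simp add: emeasure_density)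
  finally show "emeasure (std_normal_vec :: (real ^ 'd) measure) (space std_normal_vec) = 1"
    by simp
qed

lemma prob_space_normal_poisson: "prob_space (normal_poisson rate)"
  unfolding normal_poisson_def
  by (intro prob_space_pair prob_space_std_normal_vec measure_pmf.prob_space_axioms)

text \<open>
  Completing the square: \<open>|x - \<theta>|\<^sup>2 / 2 = |x|\<^sup>2 / 2 - (\<theta> \<bullet> x - |\<theta>|\<^sup>2 / 2)\<close>, while Lebesgue measure is invariant
  under translations.
\<close>

lemma std_normal_vec_shift:
  fixes \<theta> :: "real ^ 'd"
  shows "distr std_normal_vec borel (\<lambda>g. g + \<theta>) =
    density std_normal_vec (\<lambda>g. ennreal (exp (\<theta> \<bullet> g - (norm \<theta>)\<^sup>2 / 2)))"
proof -
  let ?\<phi> = "\<lambda>x :: real ^ 'd. ennreal (\<Prod>i\<in>UNIV. std_normal_density (x $ i))"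
  have dens: "(\<Prod>i\<in>UNIV. std_normal_density ((x - \<theta>) $ i)) =
      (\<Prod>i\<in>UNIV. std_normal_density (x $ i)) * exp (\<theta> \<bullet> x - (norm \<theta>)\<^sup>2 / 2)" for x
  proof -
    have "exp (\<theta> \<bullet> x - (norm \<theta>)\<^sup>2 / 2) = (\<Prod>i\<in>UNIV. exp (\<theta> $ i * x $ i - (\<theta> $ i)\<^sup>2 / 2))"
      unfolding power2_norm_eq_inner inner_vec_def
      by (simp add: exp_sum[symmetric] sum_subtractf sum_divide_distrib power2_eq_square)
    then show ?thesis
      by (simp only: prod.distrib[symmetric] std_normal_density_def)
        (intro prod.cong refl, simp add: exp_add[symmetric] mult.assoc,
          simp add: power2_eq_square field_simps)
  qed
  have "distr std_normal_vec borel (\<lambda>g. g + \<theta>) =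
      distr (density lborel (\<lambda>x. ?\<phi> ((\<theta> + x) - \<theta>))) borel ((+) \<theta>)"
    unfolding std_normal_vec_def by (simp add: add.commute[of _ \<theta>])
  also have "\<dots> = density (distr lborel borel ((+) \<theta>)) (\<lambda>x. ?\<phi> (x - \<theta>))"
  proof (rule density_distr[symmetric])
    have "(\<lambda>x. (x - \<theta>) $ i) \<in> borel_measurable borel" for i
      by (intro borel_measurable_continuous_onI continuous_intros)
    then show "(\<lambda>x. ?\<phi> (x - \<theta>)) \<in> borel_measurable borel" by measurable
    show "(+) \<theta> \<in> borel_measurable lborel"
      by (simp add: borel_measurable_continuous_onI continuous_intros)
  qed
  also have "\<dots> = density lborel (\<lambda>x. ?\<phi> (x - \<theta>))"
    by (simp only: lborel_distr_plus)
  also have "\<dots> = density std_normal_vec (\<lambda>g. ennreal (exp (\<theta> \<bullet> g - (norm \<theta>)\<^sup>2 / 2)))"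
    unfolding std_normal_vec_def
    by (subst density_density_eq) (simp_all only: dens, auto simp: ennreal_mult' prod_nonneg)
  finally show ?thesis .
qed

lemma pmf_poisson_vec:
  assumes "pos_vec rate"
  shows "pmf (poisson_vec rate) n = (\<Prod>i\<in>UNIV. rate $ i ^ (n $ i) / fact (n $ i) * exp (- (rate $ i)))"
proof -
  have "pmf (poisson_vec rate) (vec_lambda (\<lambda>i. n $ i)) =
      pmf (Pi_pmf UNIV 0 (\<lambda>i. poisson_pmf (rate $ i))) (\<lambda>i. n $ i)"
    unfolding poisson_vec_def by (rule pmf_map_inj') (auto simp: inj_def vec_lambda_inject)
  also have "\<dots> = (\<Prod>i\<in>UNIV. rate $ i ^ (n $ i) / fact (n $ i) * exp (- (rate $ i)))"
    using assms by (subst pmf_Pi') (auto simp: pos_vec_def)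
  finally show ?thesis by simp
qed

lemma poisson_vec_tilted_rate:
  assumes "pos_vec \<mu>"
  shows "measure_pmf (poisson_vec (tilted_rate \<mu> \<eta>)) =
    density (measure_pmf (poisson_vec \<mu>)) (\<lambda>n. ennreal (exp
      ((\<Sum>i\<in>UNIV. real (n $ i) * \<eta> $ i) - (\<Sum>i\<in>UNIV. \<mu> $ i * (exp (\<eta> $ i) - 1)))))"
proof -
  have "pmf (poisson_vec (tilted_rate \<mu> \<eta>)) n = pmf (poisson_vec \<mu>) n * exp
      ((\<Sum>i\<in>UNIV. real (n $ i) * \<eta> $ i) - (\<Sum>i\<in>UNIV. \<mu> $ i * (exp (\<eta> $ i) - 1)))" for n
    unfolding pmf_poisson_vec[OF assms] pmf_poisson_vec[OF pos_vec_tilted_rate[OF assms]]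
      sum_subtractf[symmetric] exp_sum[OF finite] prod.distrib[symmetric]
    by (intro prod.cong refl)
      (simp add: tilted_rate_def power_mult_distrib exp_of_nat_mult[symmetric] exp_add[symmetric]
        exp_diff exp_minus field_simps)
  then show ?thesis
    unfolding measure_pmf_eq_density
    by (subst density_density_eq) (auto simp: ennreal_mult')
qed

text \<open>
  Shifting the normal component by \<open>\<theta>\<close> and multiplying the Poisson rates by \<open>exp \<eta>\<close> both
  change the law by an exponential factor, so that the family of all laws so obtained is the
  exponential family generated by \<^term>\<open>normal_poisson \<mu>\<close>.
\<close>

lemma normal_poisson_tilt:
  fixes z :: "(real ^ 'd) \<times> (real ^ 'p)"
  assumes "pos_vec \<mu>"
  shows "distr (normal_poisson (tilted_rate \<mu> (snd z))) sample_space (\<lambda>y. (fst y + fst z, snd y)) =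
    density (normal_poisson \<mu>) (\<lambda>y. ennreal (tilt \<mu> z y))"
proof -
  let ?P = "\<lambda>l. measure_pmf (poisson_vec l)"
  let ?a = "\<lambda>g. ennreal (exp (fst z \<bullet> g - (norm (fst z))\<^sup>2 / 2))"
  let ?b = "\<lambda>n. ennreal (exp
      ((\<Sum>i\<in>UNIV. real (n $ i) * snd z $ i) - (\<Sum>i\<in>UNIV. \<mu> $ i * (exp (snd z $ i) - 1))))"
  let ?R = "?P (tilted_rate \<mu> (snd z))"
  have "distr (normal_poisson (tilted_rate \<mu> (snd z))) sample_space (\<lambda>y. (fst y + fst z, snd y)) =
      distr (std_normal_vec \<Otimes>\<^sub>M ?R) (borel \<Otimes>\<^sub>M count_space UNIV) (\<lambda>(g, n). (g + fst z, n))"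
    by (simp add: normal_poisson_def case_prod_beta')
  also have "\<dots> = distr std_normal_vec borel (\<lambda>g. g + fst z) \<Otimes>\<^sub>M distr ?R (count_space UNIV) (\<lambda>n. n)"
    by (rule pair_measure_distr[symmetric])
      (auto intro!: prob_space_imp_sigma_finite measure_pmf.prob_space_distr)
  also have "distr ?R (count_space UNIV) (\<lambda>n. n) = ?R"
    by (rule distr_id2) simp
  also have "distr std_normal_vec borel (\<lambda>g. g + fst z) \<Otimes>\<^sub>M ?R =
      density std_normal_vec ?a \<Otimes>\<^sub>M density (?P \<mu>) ?b"
    by (simp only: std_normal_vec_shift poisson_vec_tilted_rate[OF assms])
  also have "\<dots> = density (std_normal_vec \<Otimes>\<^sub>M ?P \<mu>) (\<lambda>(g, n). ?a g * ?b n)"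
    by (rule pair_measure_density)
      (auto simp: poisson_vec_tilted_rate[OF assms, symmetric] intro: measure_pmf.sigma_finite_measure_axioms)
  also have "(\<lambda>(g, n). ?a g * ?b n) = (\<lambda>y. ennreal (tilt \<mu> z y))"
    by (auto simp: fun_eq_iff tilt_def pairing_def cumulant_def ennreal_mult'[symmetric] exp_add[symmetric]
        algebra_simps)
  finally show ?thesis by (simp add: normal_poisson_def)
qed

lemma prob_space_tilt:
  assumes "pos_vec \<mu>"
  shows "prob_space (density (normal_poisson \<mu>) (\<lambda>y. ennreal (tilt \<mu> z y)))"
  unfolding normal_poisson_tilt[OF assms, symmetric]
  by (intro prob_space.prob_space_distr prob_space_normal_poisson) measurable

lemma nn_integral_tilt:
  assumes "pos_vec \<mu>"
  shows "(\<integral>\<^sup>+y. ennreal (tilt \<mu> z y) \<partial>normal_poisson \<mu>) = 1"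
proof -
  interpret prob_space "density (normal_poisson \<mu>) (\<lambda>y. ennreal (tilt \<mu> z y))"
    by (rule prob_space_tilt[OF assms])
  have "emeasure (density (normal_poisson \<mu>) (\<lambda>y. ennreal (tilt \<mu> z y))) (space (normal_poisson \<mu>)) =
      (\<integral>\<^sup>+y. ennreal (tilt \<mu> z y) * indicator (space (normal_poisson \<mu>)) y \<partial>normal_poisson \<mu>)"
    by (rule emeasure_density) measurable
  then show ?thesis using emeasure_space_1 by simp
qed

lemma integral_tilt:
  assumes "pos_vec \<mu>"
  shows "integrable (normal_poisson \<mu>) (tilt \<mu> z)"
    and "integral\<^sup>L (normal_poisson \<mu>) (tilt \<mu> z) = 1"
proof -
  show "integrable (normal_poisson \<mu>) (tilt \<mu> z)"
    using nn_integral_tilt[OF assms, of z] by (intro integrableI_nonneg) (auto simp: less_imp_le[OF tilt_pos])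
  then show "integral\<^sup>L (normal_poisson \<mu>) (tilt \<mu> z) = 1"
    using nn_integral_tilt[OF assms, of z] nn_integral_eq_integral[of _ "tilt \<mu> z"]
    by (auto simp: less_imp_le[OF tilt_pos])
qed

text \<open>
  The negative powers of \<open>tilt\<close> are again multiples of members of the family, which gives all
  their moments.
\<close>

lemma tilt_powr_minus:
  "tilt \<mu> z y powr (- s) = exp (cumulant \<mu> (- s *\<^sub>R z) + s * cumulant \<mu> z) * tilt \<mu> (- s *\<^sub>R z) y"
proof -
  have "pairing (- s *\<^sub>R z) y = - s * pairing z y"
    by (simp add: pairing_def sum_distrib_left sum_negf algebra_simps)
  then show ?thesis
    by (simp add: tilt_def powr_def exp_add[symmetric] algebra_simps)
qed

text \<open>
  Young's inequality replaces a product by a sum: \<open>a\<^sup>4 t\<close> is at most \<open>a\<^sup>4\<^sup>+\<^sup>\<delta>\<close> if \<open>t \<le> a\<^sup>\<delta>\<close>, and at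
  most \<open>t\<^sup>1\<^sup>+\<^sup>4\<^sup>/\<^sup>\<delta>\<close> otherwise.
\<close>

lemma young_power4:
  fixes a t \<delta> :: real
  assumes "0 \<le> a" "0 < t" "0 < \<delta>"
  shows "a ^ 4 * t \<le> a powr (4 + \<delta>) + t powr (1 + 4 / \<delta>)"
proof (cases "t \<le> a powr \<delta>")
  case True
  show ?thesis
  proof (cases "a = 0")
    case False
    then have "a ^ 4 * t \<le> a powr 4 * a powr \<delta>"
      using True assms by (intro mult_mono) auto
    also have "\<dots> = a powr (4 + \<delta>)" by (simp add: powr_add)
    finally show ?thesis using powr_ge_zero[of t "1 + 4 / \<delta>"] by linarith
  qed (use assms in auto)
next
  case False
  have "a = (a powr \<delta>) powr (1 / \<delta>)" using assms by (simp add: powr_powr)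
  also have "\<dots> \<le> t powr (1 / \<delta>)" using False assms by (intro powr_mono2) auto
  finally have "a ^ 4 \<le> (t powr (1 / \<delta>)) ^ 4" using assms by (intro power_mono) auto
  also have "\<dots> = t powr (4 / \<delta>)" using assms by (simp add: powr_powr flip: powr_numeral)
  finally have "a ^ 4 * t \<le> t powr (4 / \<delta>) * t" using assms by (intro mult_right_mono) auto
  also have "\<dots> = t powr (1 + 4 / \<delta>)" using assms by (simp add: powr_add)
  finally show ?thesis using powr_ge_zero[of a "4 + \<delta>"] by linarith
qed

text \<open>
  The case \<open>s = 3\<close> is the fourth moment of a summand of the estimator, the case \<open>s = 2\<close> the second
  moment of a summand of the function that is minimized. Young's inequality separates \<open>f\<close> from
  the negative power of \<open>tilt\<close>, whose integral is explicit. What matters about the bound is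
  that it is a continuous function of \<open>z\<close>.
\<close>

lemma integral_power4_tilt:
  fixes f :: "(real ^ 'd) \<times> (nat ^ 'p) \<Rightarrow> real" and s \<delta> :: real
  assumes "pos_vec \<mu>" "0 < \<delta>"
    and [measurable]: "f \<in> borel_measurable sample_space"
    and f: "integrable (normal_poisson \<mu>) (\<lambda>y. \<bar>f y\<bar> powr (4 + \<delta>))"
  defines "q \<equiv> s * (1 + 4 / \<delta>)"
  shows "integrable (normal_poisson \<mu>) (\<lambda>y. f y ^ 4 * tilt \<mu> z y powr (- s))" (is ?int)
    and "(\<integral>y. f y ^ 4 * tilt \<mu> z y powr (- s) \<partial>normal_poisson \<mu>) \<le>
      (\<integral>y. \<bar>f y\<bar> powr (4 + \<delta>) \<partial>normal_poisson \<mu>) + exp (cumulant \<mu> (- q *\<^sub>R z) + q * cumulant \<mu> z)" (is ?le)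
proof -
  let ?c = "exp (cumulant \<mu> (- q *\<^sub>R z) + q * cumulant \<mu> z)"
  have *: "f y ^ 4 * tilt \<mu> z y powr (- s) \<le> \<bar>f y\<bar> powr (4 + \<delta>) + ?c * tilt \<mu> (- q *\<^sub>R z) y" for y
  proof -
    have "f y ^ 4 * tilt \<mu> z y powr (- s) \<le>
        \<bar>f y\<bar> powr (4 + \<delta>) + (tilt \<mu> z y powr (- s)) powr (1 + 4 / \<delta>)"
      using young_power4[of "\<bar>f y\<bar>" "tilt \<mu> z y powr (- s)" \<delta>] assms(2) tilt_pos[of \<mu> z y] by simp
    also have "(tilt \<mu> z y powr (- s)) powr (1 + 4 / \<delta>) = tilt \<mu> z y powr (- q)"
      by (simp add: powr_powr q_def)
    finally show ?thesis by (simp only: tilt_powr_minus)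
  qed
  have int: "integrable (normal_poisson \<mu>) (\<lambda>y. \<bar>f y\<bar> powr (4 + \<delta>) + ?c * tilt \<mu> (- q *\<^sub>R z) y)"
    by (intro Bochner_Integration.integrable_add integrable_mult_right f integral_tilt(1) assms(1))
  show ?int
  proof (rule Bochner_Integration.integrable_bound[OF int])
    have "norm (f y ^ 4 * tilt \<mu> z y powr (- s)) \<le> norm (\<bar>f y\<bar> powr (4 + \<delta>) + ?c * tilt \<mu> (- q *\<^sub>R z) y)" for y
      using order_trans[OF *[of y] abs_ge_self] by (simp add: abs_mult)
    then show "AE y in normal_poisson \<mu>. norm (f y ^ 4 * tilt \<mu> z y powr (- s)) \<le>
        norm (\<bar>f y\<bar> powr (4 + \<delta>) + ?c * tilt \<mu> (- q *\<^sub>R z) y)" by simp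
  qed measurable
  then have "(\<integral>y. f y ^ 4 * tilt \<mu> z y powr (- s) \<partial>normal_poisson \<mu>) \<le>
      (\<integral>y. \<bar>f y\<bar> powr (4 + \<delta>) + ?c * tilt \<mu> (- q *\<^sub>R z) y \<partial>normal_poisson \<mu>)"
    by (intro integral_mono int *)
  also have "\<dots> = (\<integral>y. \<bar>f y\<bar> powr (4 + \<delta>) \<partial>normal_poisson \<mu>) + ?c"
    by (subst Bochner_Integration.integral_add)
      (simp_all add: f integral_tilt[OF assms(1)])
  finally show ?le .
qed

section \<open>Moments of sums of independent variables\<close>

lemma integrable_power_le_4:
  fixes h :: "'a \<Rightarrow> real"
  assumes "finite_measure M" "h \<in> borel_measurable M" "integrable M (\<lambda>x. h x ^ 4)" "k \<le> 4"
  shows "integrable M (\<lambda>x. h x ^ k)"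
proof -
  interpret finite_measure M by fact
  have le: "\<bar>t\<bar> ^ k \<le> 1 + t ^ 4" for t :: real
  proof (cases "\<bar>t\<bar> \<le> 1")
    case True
    then have "\<bar>t\<bar> ^ k \<le> 1" by (intro power_le_one) auto
    moreover have "0 \<le> t ^ 4" by simp
    ultimately show ?thesis by linarith
  next
    case False
    then have "\<bar>t\<bar> ^ k \<le> \<bar>t\<bar> ^ 4" using assms(4) by (intro power_increasing) auto
    then show ?thesis by simp
  qed
  have "integrable M (\<lambda>x. 1 + h x ^ 4)" using assms(3) by auto
  then show ?thesis
  proof (rule Bochner_Integration.integrable_bound)
    have "norm (h x ^ k) \<le> norm (1 + h x ^ 4)" for x
      using order_trans[OF le[of "h x"] abs_ge_self] by (simp add: power_abs)
    then show "AE x in M. norm (h x ^ k) \<le> norm (1 + h x ^ 4)" by simp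
  qed (use assms(2) in measurable)
qed

lemma (in prob_space) square_expectation_le:
  fixes h :: "'a \<Rightarrow> real"
  assumes [measurable]: "h \<in> borel_measurable M" and "integrable M (\<lambda>x. (h x)\<^sup>2)"
  shows "(expectation h)\<^sup>2 \<le> expectation (\<lambda>x. (h x)\<^sup>2)"
    and "expectation (\<lambda>x. (h x - expectation h)\<^sup>2) \<le> expectation (\<lambda>x. (h x)\<^sup>2)"
proof -
  have "integrable M h" using assms by (rule square_integrable_imp_integrable)
  then have "variance h = expectation (\<lambda>x. (h x)\<^sup>2) - (expectation h)\<^sup>2"
    using assms by (intro variance_eq)
  then show "(expectation h)\<^sup>2 \<le> expectation (\<lambda>x. (h x)\<^sup>2)"
    and "expectation (\<lambda>x. (h x - expectation h)\<^sup>2) \<le> expectation (\<lambda>x. (h x)\<^sup>2)"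
    using variance_positive[of h] by auto
qed

lemma (in prob_space) indep_vars_sum_second_moment:
  fixes X :: "'i \<Rightarrow> 'a \<Rightarrow> real"
  assumes "finite I" "indep_vars (\<lambda>_. borel) X I"
    and "\<And>i. i \<in> I \<Longrightarrow> integrable M (\<lambda>\<omega>. (X i \<omega>)\<^sup>2)"
    and "\<And>i. i \<in> I \<Longrightarrow> expectation (X i) = 0"
    and "\<And>i. i \<in> I \<Longrightarrow> expectation (\<lambda>\<omega>. (X i \<omega>)\<^sup>2) \<le> C"
  shows "integrable M (\<lambda>\<omega>. (\<Sum>i\<in>I. X i \<omega>)\<^sup>2)"
    and "expectation (\<lambda>\<omega>. (\<Sum>i\<in>I. X i \<omega>)\<^sup>2) \<le> real (card I) * C"
proof -
  have "integrable M (\<lambda>\<omega>. (\<Sum>i\<in>I. X i \<omega>)\<^sup>2) \<and>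
      expectation (\<lambda>\<omega>. (\<Sum>i\<in>I. X i \<omega>)\<^sup>2) \<le> real (card I) * C"
    using assms
  proof (induction I rule: finite_induct)
    case (insert i I)
    define S where "S = (\<lambda>\<omega>. \<Sum>i\<in>I. X i \<omega>)"
    have rv: "X j \<in> borel_measurable M" if "j \<in> insert i I" for j
      using insert.prems(1) that by (auto simp: indep_vars_def)
    have [measurable]: "S \<in> borel_measurable M" "X i \<in> borel_measurable M"
      unfolding S_def using rv by auto
    have IH: "integrable M (\<lambda>\<omega>. (S \<omega>)\<^sup>2)" "expectation (\<lambda>\<omega>. (S \<omega>)\<^sup>2) \<le> real (card I) * C"
      using insert.IH insert.prems indep_vars_subset[OF insert.prems(1)] by (auto simp: S_def)
    have int: "integrable M S" "integrable M (X i)"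
      using IH(1) insert.prems(2)[of i] by (auto intro: square_integrable_imp_integrable)
    have ind: "indep_var borel (X i) borel S"
      unfolding S_def using insert by (intro indep_vars_sum) auto
    note prod = indep_var_integrable[OF ind int(2,1)] indep_var_lebesgue_integral[OF ind int(2,1)]
    have eq: "(\<Sum>j\<in>insert i I. X j \<omega>)\<^sup>2 = (X i \<omega>)\<^sup>2 + (2 * (X i \<omega> * S \<omega>) + (S \<omega>)\<^sup>2)" for \<omega>
      using insert.hyps by (simp add: S_def power2_sum algebra_simps)
    have "expectation (\<lambda>\<omega>. (\<Sum>j\<in>insert i I. X j \<omega>)\<^sup>2) =
        expectation (\<lambda>\<omega>. (X i \<omega>)\<^sup>2) + expectation (\<lambda>\<omega>. (S \<omega>)\<^sup>2)"
      unfolding eq using insert.prems(2,3)[of i] IH(1) prod by simp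
    moreover have "integrable M (\<lambda>\<omega>. (\<Sum>j\<in>insert i I. X j \<omega>)\<^sup>2)"
      unfolding eq using insert.prems(2)[of i] IH(1) prod(1) by simp
    ultimately show ?case
      using IH(2) insert.prems(4)[of i] insert.hyps by (simp add: algebra_simps)
  qed simp
  then show "integrable M (\<lambda>\<omega>. (\<Sum>i\<in>I. X i \<omega>)\<^sup>2)"
    and "expectation (\<lambda>\<omega>. (\<Sum>i\<in>I. X i \<omega>)\<^sup>2) \<le> real (card I) * C" by auto
qed

text \<open>
  Of the terms in the expansion of \<open>(X + S)\<^sup>4\<close>, with \<open>X\<close> independent of the partial sum \<open>S\<close>, those of
  odd degree in \<open>X\<close> or \<open>S\<close> contain a factor of degree one, which is centred. Hence the fourth moment
  grows by \<open>6 E X\<^sup>2 E S\<^sup>2 + E X\<^sup>4\<close>, which is at most \<open>6 k C + C\<close> after \<open>k\<close> steps, because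
  \<open>(E X\<^sup>2)\<^sup>2 \<le> E X\<^sup>4 \<le> C\<close>.
\<close>

lemma (in prob_space) indep_vars_sum_fourth_moment:
  fixes X :: "'i \<Rightarrow> 'a \<Rightarrow> real"
  assumes "finite I" "indep_vars (\<lambda>_. borel) X I"
    and "\<And>i. i \<in> I \<Longrightarrow> integrable M (\<lambda>\<omega>. X i \<omega> ^ 4)"
    and "\<And>i. i \<in> I \<Longrightarrow> expectation (X i) = 0"
    and "\<And>i. i \<in> I \<Longrightarrow> expectation (\<lambda>\<omega>. X i \<omega> ^ 4) \<le> C" and "0 \<le> C"
  shows "integrable M (\<lambda>\<omega>. (\<Sum>i\<in>I. X i \<omega>) ^ 4)"
    and "expectation (\<lambda>\<omega>. (\<Sum>i\<in>I. X i \<omega>) ^ 4) \<le> 3 * (real (card I))\<^sup>2 * C"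
proof -
  have "integrable M (\<lambda>\<omega>. (\<Sum>i\<in>I. X i \<omega>) ^ 4) \<and>
      expectation (\<lambda>\<omega>. (\<Sum>i\<in>I. X i \<omega>) ^ 4) \<le> 3 * (real (card I))\<^sup>2 * C"
    using assms
  proof (induction I rule: finite_induct)
    case (insert i I)
    define S where "S = (\<lambda>\<omega>. \<Sum>i\<in>I. X i \<omega>)"
    have rv: "X j \<in> borel_measurable M" if "j \<in> insert i I" for j
      using insert.prems(1) that by (auto simp: indep_vars_def)
    have [measurable]: "S \<in> borel_measurable M" "X i \<in> borel_measurable M"
      unfolding S_def using rv by auto
    have IH: "integrable M (\<lambda>\<omega>. S \<omega> ^ 4)" "expectation (\<lambda>\<omega>. S \<omega> ^ 4) \<le> 3 * (real (card I))\<^sup>2 * C"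
      using insert.IH insert.prems indep_vars_subset[OF insert.prems(1)] by (auto simp: S_def)
    have intX: "integrable M (\<lambda>\<omega>. X j \<omega> ^ k)" if "k \<le> 4" "j \<in> insert i I" for j k
      by (rule integrable_power_le_4[OF finite_measure_axioms rv[OF that(2)] insert.prems(2)[OF that(2)] that(1)])
    have intS: "integrable M (\<lambda>\<omega>. S \<omega> ^ k)" if "k \<le> 4" for k
      by (rule integrable_power_le_4[OF finite_measure_axioms _ IH(1) that]) measurable
    have ind: "indep_var borel (X i) borel S"
      unfolding S_def using insert by (intro indep_vars_sum) auto
    have prod: "integrable M (\<lambda>\<omega>. X i \<omega> ^ k * S \<omega> ^ l)"
      "expectation (\<lambda>\<omega>. X i \<omega> ^ k * S \<omega> ^ l) = expectation (\<lambda>\<omega>. X i \<omega> ^ k) * expectation (\<lambda>\<omega>. S \<omega> ^ l)"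
      if "k \<le> 4" "l \<le> 4" for k l
    proof -
      have "indep_var borel ((\<lambda>t. t ^ k) \<circ> X i) borel ((\<lambda>t. t ^ l) \<circ> S)"
        by (rule indep_var_compose[OF ind]) auto
      then have "indep_var borel (\<lambda>\<omega>. X i \<omega> ^ k) borel (\<lambda>\<omega>. S \<omega> ^ l)" by (simp add: comp_def)
      from indep_var_integrable[OF this] indep_var_lebesgue_integral[OF this]
      show "integrable M (\<lambda>\<omega>. X i \<omega> ^ k * S \<omega> ^ l)"
        "expectation (\<lambda>\<omega>. X i \<omega> ^ k * S \<omega> ^ l) = expectation (\<lambda>\<omega>. X i \<omega> ^ k) * expectation (\<lambda>\<omega>. S \<omega> ^ l)"
        using intX[of k i] intS[of l] that by auto
    qed
    have ES: "expectation S = 0"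
      unfolding S_def using insert.prems(3) intX[of 1]
      by (subst Bochner_Integration.integral_sum) auto
    have X2: "expectation (\<lambda>\<omega>. (X j \<omega>)\<^sup>2) \<le> sqrt C" if "j \<in> insert i I" for j
    proof -
      have "(expectation (\<lambda>\<omega>. (X j \<omega>)\<^sup>2))\<^sup>2 \<le> expectation (\<lambda>\<omega>. ((X j \<omega>)\<^sup>2)\<^sup>2)"
        using intX[OF _ that, of 4] rv[OF that] by (intro square_expectation_le) (auto simp: power_mult[symmetric])
      also have "\<dots> \<le> C" using insert.prems(4)[OF that] by (simp add: power_mult[symmetric])
      finally show ?thesis by (rule real_le_rsqrt)
    qed
    have "expectation (\<lambda>\<omega>. (S \<omega>)\<^sup>2) \<le> real (card I) * sqrt C"
      unfolding S_def using insert.hyps(1) indep_vars_subset[OF insert.prems(1), of I] intX[of 2] insert.prems(3) X2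
      by (intro indep_vars_sum_second_moment(2)) auto
    then have "expectation (\<lambda>\<omega>. (X i \<omega>)\<^sup>2) * expectation (\<lambda>\<omega>. (S \<omega>)\<^sup>2) \<le> sqrt C * (real (card I) * sqrt C)"
      using X2[of i] insert.prems(5) by (intro mult_mono) auto
    also have "\<dots> = real (card I) * C" using insert.prems(5) by simp
    finally have X2S2: "expectation (\<lambda>\<omega>. (X i \<omega>)\<^sup>2 * (S \<omega>)\<^sup>2) \<le> real (card I) * C"
      using prod(2)[of 2 2] by simp
    have eq: "(\<Sum>j\<in>insert i I. X j \<omega>) ^ 4 = X i \<omega> ^ 4 + (4 * (X i \<omega> ^ 3 * S \<omega> ^ 1) +
        (6 * ((X i \<omega>)\<^sup>2 * (S \<omega>)\<^sup>2) + (4 * (X i \<omega> ^ 1 * S \<omega> ^ 3) + S \<omega> ^ 4)))" for \<omega>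
      using insert.hyps by (simp add: S_def[symmetric] eval_nat_numeral algebra_simps) (simp add: S_def)
    have int: "integrable M (\<lambda>\<omega>. X i \<omega> ^ 4)" "integrable M (\<lambda>\<omega>. S \<omega> ^ 4)"
      "integrable M (\<lambda>\<omega>. X i \<omega> ^ 3 * S \<omega> ^ 1)" "integrable M (\<lambda>\<omega>. (X i \<omega>)\<^sup>2 * (S \<omega>)\<^sup>2)"
      "integrable M (\<lambda>\<omega>. X i \<omega> ^ 1 * S \<omega> ^ 3)"
      using intX[of 4 i] IH(1) prod(1)[of 3 1] prod(1)[of 2 2] prod(1)[of 1 3] by auto
    have "expectation (\<lambda>\<omega>. (\<Sum>j\<in>insert i I. X j \<omega>) ^ 4) = expectation (\<lambda>\<omega>. X i \<omega> ^ 4) +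
        6 * expectation (\<lambda>\<omega>. (X i \<omega>)\<^sup>2 * (S \<omega>)\<^sup>2) + expectation (\<lambda>\<omega>. S \<omega> ^ 4)"
      unfolding eq using int ES insert.prems(3)[of i] prod(2)[of 3 1] prod(2)[of 1 3]
      by (simp add: Bochner_Integration.integral_add)
    also have "\<dots> \<le> C + 6 * (real (card I) * C) + 3 * (real (card I))\<^sup>2 * C"
      using IH(2) X2S2 insert.prems(4)[of i] by auto
    also have "\<dots> \<le> 3 * (real (card (insert i I)))\<^sup>2 * C"
      using insert.hyps insert.prems(5) by (simp add: power2_eq_square algebra_simps)
    finally have "expectation (\<lambda>\<omega>. (\<Sum>j\<in>insert i I. X j \<omega>) ^ 4) \<le> 3 * (real (card (insert i I)))\<^sup>2 * C" .
    moreover have "integrable M (\<lambda>\<omega>. (\<Sum>j\<in>insert i I. X j \<omega>) ^ 4)"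
      unfolding eq using int by (intro Bochner_Integration.integrable_add integrable_mult_right) auto
    ultimately show ?case by simp
  qed simp
  then show "integrable M (\<lambda>\<omega>. (\<Sum>i\<in>I. X i \<omega>) ^ 4)"
    and "expectation (\<lambda>\<omega>. (\<Sum>i\<in>I. X i \<omega>) ^ 4) \<le> 3 * (real (card I))\<^sup>2 * C" by auto
qed

lemma indep_vars_PiM_coordinates:
  assumes "prob_space P" "I \<noteq> {}"
  shows "prob_space.indep_vars (PiM I (\<lambda>_. P)) (\<lambda>_. P) (\<lambda>i x. x i) I"
proof -
  interpret Q: prob_space "PiM I (\<lambda>_. P)" by (intro prob_space_PiM assms)
  have "distr (PiM I (\<lambda>_. P)) (PiM I (\<lambda>_. P)) (\<lambda>x. \<lambda>i\<in>I. x i) =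
      distr (PiM I (\<lambda>_. P)) (PiM I (\<lambda>_. P)) (\<lambda>x. x)"
    by (rule distr_cong) (auto simp: space_PiM PiE_restrict)
  then have "distr (PiM I (\<lambda>_. P)) (PiM I (\<lambda>_. P)) (\<lambda>x. \<lambda>i\<in>I. x i) = PiM I (\<lambda>_. P)"
    by (simp only: distr_id)
  moreover have "distr (PiM I (\<lambda>_. P)) P (\<lambda>x. x i) = P" if "i \<in> I" for i
    using distr_PiM_component[of I "\<lambda>_. P" i] assms that by simp
  ultimately show ?thesis
    by (subst Q.indep_vars_iff_distr_eq_PiM'[OF assms(2)]) (measurable, simp cong: PiM_cong)
qed

text \<open>
  The deviation of an average of \<open>n\<close> independent copies of \<open>h\<close> has a fourth moment of order
  \<open>n\<^sup>-\<^sup>2\<close>; this order makes the deviation probabilities summable in \<open>n\<close> without any assumption on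
  the joint law of the averages for different \<open>n\<close>.
\<close>

lemma PiM_average_deviation:
  fixes h :: "'a \<Rightarrow> real"
  assumes "prob_space P" and [measurable]: "h \<in> borel_measurable P"
    and h4: "integrable P (\<lambda>x. h x ^ 4)" and "1 \<le> n" "0 < e"
  shows "measure (PiM {1..n} (\<lambda>_. P)) {x \<in> space (PiM {1..n} (\<lambda>_. P)).
      e \<le> \<bar>(1 / real n) * (\<Sum>j=1..n. h (x j)) - integral\<^sup>L P h\<bar>} \<le>
    48 * (\<integral>x. h x ^ 4 \<partial>P) / e ^ 4 * (1 / (real n)\<^sup>2)"
proof -
  interpret P: prob_space P by fact
  let ?Q = "PiM {1..n} (\<lambda>_. P)"
  interpret Q: prob_space ?Q by (intro prob_space_PiM assms)
  define c where "c = integral\<^sup>L P h"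
  define X where "X = (\<lambda>(j :: nat) x. h (x j) - c)"
  \<comment> \<open>\<open>16 = 8 + 8\<close>: \<open>(h - c)\<^sup>4 \<le> 8 h\<^sup>4 + 8 c\<^sup>4\<close>, and \<open>c\<^sup>4\<close> is at most the mean of \<open>h\<^sup>4\<close>\<close>
  define C where "C = 16 * (\<integral>x. h x ^ 4 \<partial>P)"
  have int: "integrable P (\<lambda>x. h x ^ k)" if "k \<le> 4" for k
    by (rule integrable_power_le_4[OF P.finite_measure_axioms _ h4 that]) measurable
  have "c ^ 4 = (c\<^sup>2)\<^sup>2" by (simp add: power_mult[symmetric])
  also have "\<dots> \<le> (\<integral>x. (h x)\<^sup>2 \<partial>P)\<^sup>2"
    unfolding c_def using int[of 2] by (intro power_mono P.square_expectation_le(1)) auto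
  also have "\<dots> \<le> (\<integral>x. ((h x)\<^sup>2)\<^sup>2 \<partial>P)"
    using int[of 4] by (intro P.square_expectation_le(1)) (auto simp: power_mult[symmetric])
  finally have c4: "c ^ 4 \<le> (\<integral>x. h x ^ 4 \<partial>P)" by (simp add: power_mult[symmetric])
  have dev4: "(t - c) ^ 4 \<le> 8 * t ^ 4 + 8 * c ^ 4" for t
  proof -
    have "(t - c)\<^sup>2 \<le> 2 * t\<^sup>2 + 2 * c\<^sup>2"
      using zero_le_power2[of "t + c"] by (simp add: power2_sum power2_diff)
    then have "((t - c)\<^sup>2)\<^sup>2 \<le> (2 * t\<^sup>2 + 2 * c\<^sup>2)\<^sup>2"
      by (rule power_mono) simp
    also have "\<dots> \<le> 8 * (t\<^sup>2)\<^sup>2 + 8 * (c\<^sup>2)\<^sup>2"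
      using zero_le_power2[of "t\<^sup>2 - c\<^sup>2"] by (simp add: power2_sum power2_diff power_mult_distrib)
    finally show ?thesis by (simp add: power_mult[symmetric])
  qed
  have int8: "integrable P (\<lambda>x. 8 * h x ^ 4 + 8 * c ^ 4)" using int[of 4] by auto
  have dev_int: "integrable P (\<lambda>x. (h x - c) ^ 4)"
  proof (rule Bochner_Integration.integrable_bound[OF int8])
    have "norm ((h x - c) ^ 4) \<le> norm (8 * h x ^ 4 + 8 * c ^ 4)" for x
      using order_trans[OF dev4[of "h x"] abs_ge_self] by simp
    then show "AE x in P. norm ((h x - c) ^ 4) \<le> norm (8 * h x ^ 4 + 8 * c ^ 4)" by simp
  qed measurable
  have "(\<integral>x. (h x - c) ^ 4 \<partial>P) \<le> (\<integral>x. 8 * h x ^ 4 + 8 * c ^ 4 \<partial>P)"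
    by (intro integral_mono dev_int int8 dev4)
  also have "\<dots> \<le> C" using int[of 4] c4 by (simp add: C_def P.prob_space)
  finally have dev_le: "(\<integral>x. (h x - c) ^ 4 \<partial>P) \<le> C" .
  have C0: "0 \<le> C" by (simp add: C_def)

  have transfer: "integrable ?Q (\<lambda>x. g (x j)) = integrable P g" "(\<integral>x. g (x j) \<partial>?Q) = integral\<^sup>L P g"
    if "j \<in> {1..n}" and [measurable]: "g \<in> borel_measurable P" for g :: "'a \<Rightarrow> real" and j
  proof -
    have d: "distr ?Q P (\<lambda>x. x j) = P"
      using distr_PiM_component[of "{1..n}" "\<lambda>_. P" j] assms that by simp
    have [measurable]: "(\<lambda>x. x j) \<in> ?Q \<rightarrow>\<^sub>M P" by (rule measurable_component_singleton) fact
    have "integrable (distr ?Q P (\<lambda>x. x j)) g = integrable ?Q (\<lambda>x. g (x j))"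
      by (rule integrable_distr_eq) measurable
    then show "integrable ?Q (\<lambda>x. g (x j)) = integrable P g" by (simp only: d)
    have "integral\<^sup>L (distr ?Q P (\<lambda>x. x j)) g = (\<integral>x. g (x j) \<partial>?Q)"
      by (rule integral_distr) measurable
    then show "(\<integral>x. g (x j) \<partial>?Q) = integral\<^sup>L P g" by (simp only: d)
  qed
  have ind: "Q.indep_vars (\<lambda>_. borel) X {1..n}"
    unfolding X_def
    by (rule Q.indep_vars_compose2[OF indep_vars_PiM_coordinates[OF assms(1)]])
      (use assms(4) in auto)
  have X4: "integrable ?Q (\<lambda>x. X j x ^ 4)" "(\<integral>x. X j x ^ 4 \<partial>?Q) \<le> C" "integral\<^sup>L ?Q (X j) = 0"
    if "j \<in> {1..n}" for j
  proof -
    show "integrable ?Q (\<lambda>x. X j x ^ 4)"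
      unfolding X_def using transfer(1)[OF that, of "\<lambda>x. (h x - c) ^ 4"] dev_int by simp
    show "(\<integral>x. X j x ^ 4 \<partial>?Q) \<le> C"
      unfolding X_def using transfer(2)[OF that, of "\<lambda>x. (h x - c) ^ 4"] dev_le by simp
    have "integral\<^sup>L P (\<lambda>x. h x - c) = 0"
      using int[of 1] by (simp add: c_def P.prob_space)
    then show "integral\<^sup>L ?Q (X j) = 0"
      unfolding X_def using transfer(2)[OF that, of "\<lambda>x. h x - c"] by simp
  qed
  note S4 = Q.indep_vars_sum_fourth_moment[OF finite_atLeastAtMost ind X4(1,3,2) C0]
  have [measurable]: "X j \<in> borel_measurable ?Q" if "j \<in> {1..n}" for j
    unfolding X_def using that by measurable
  have [measurable]: "(\<lambda>x. \<Sum>j=1..n. X j x) \<in> borel_measurable ?Q" by measurable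
  have eq: "(1 / real n) * (\<Sum>j=1..n. h (x j)) - c = (\<Sum>j=1..n. X j x) / real n" for x
    using assms(4) by (simp add: X_def sum_subtractf field_simps)
  have sub: "{x \<in> space ?Q. e \<le> \<bar>(\<Sum>j=1..n. X j x) / real n\<bar>} \<subseteq>
      {x \<in> space ?Q. (e * real n) ^ 4 \<le> (\<Sum>j=1..n. X j x) ^ 4}"
  proof safe
    fix x assume "e \<le> \<bar>(\<Sum>j=1..n. X j x) / real n\<bar>"
    then have "(e * real n) ^ 4 \<le> \<bar>\<Sum>j=1..n. X j x\<bar> ^ 4"
      using assms(4,5) by (intro power_mono) (auto simp: field_simps abs_divide)
    then show "(e * real n) ^ 4 \<le> (\<Sum>j=1..n. X j x) ^ 4" by simp
  qed
  have "measure ?Q {x \<in> space ?Q. e \<le> \<bar>(\<Sum>j=1..n. X j x) / real n\<bar>} \<le>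
      measure ?Q {x \<in> space ?Q. (e * real n) ^ 4 \<le> (\<Sum>j=1..n. X j x) ^ 4}"
    by (intro Q.finite_measure_mono sub) measurable
  also have "\<dots> \<le> (\<integral>x. (\<Sum>j=1..n. X j x) ^ 4 \<partial>?Q) / (e * real n) ^ 4"
    using S4(1) assms(4,5) by (intro integral_Markov_inequality_measure[where A = "{}"]) auto
  also have "\<dots> \<le> 3 * (real n)\<^sup>2 * C / (e * real n) ^ 4"
    using S4(2) assms(4,5) by (intro divide_right_mono) auto
  also have "\<dots> = 48 * (\<integral>x. h x ^ 4 \<partial>P) / e ^ 4 * (1 / (real n)\<^sup>2)"
  proof -
    have cancel: "3 * a * (16 * I) / (E * (a * a)) = 48 * I / E * (1 / a)" if "a \<noteq> 0" "E \<noteq> 0"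
      for a E I :: real
      using that by (simp add: field_simps)
    have "(e * real n) ^ 4 = e ^ 4 * ((real n)\<^sup>2 * (real n)\<^sup>2)"
      by (simp add: power_mult_distrib flip: power_add)
    then show ?thesis
      unfolding C_def using assms(4,5) by (simp only:) (rule cancel, auto)
  qed
  finally show ?thesis by (simp only: eq c_def[symmetric])
qed

text \<open>
  Along powers of two, Chebyshev's inequality gives summable deviation probabilities. For
  \<open>2\<^sup>k \<le> m < 2\<^sup>k\<^sup>+\<^sup>1\<close> the monotonicity of the partial sums of a nonnegative sequence compares the
  average over \<open>m\<close> terms with the two adjacent dyadic ones, at the price of a factor of two.
\<close>

lemma (in prob_space) AE_eventually_averages_bounded:
  fixes X :: "nat \<Rightarrow> 'a \<Rightarrow> real"
  assumes ind: "indep_vars (\<lambda>_. borel) X {1..}"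
    and nonneg: "\<And>j \<omega>. 1 \<le> j \<Longrightarrow> 0 \<le> X j \<omega>"
    and sq: "\<And>j. 1 \<le> j \<Longrightarrow> integrable M (\<lambda>\<omega>. (X j \<omega>)\<^sup>2)"
    and mean: "\<And>j. 1 \<le> j \<Longrightarrow> expectation (X j) = a"
    and bound: "\<And>j. 1 \<le> j \<Longrightarrow> expectation (\<lambda>\<omega>. (X j \<omega>)\<^sup>2) \<le> C"
    and "0 < e"
  shows "AE \<omega> in M. \<forall>\<^sub>F m in sequentially.
    (a - e) / 2 \<le> (\<Sum>j=1..m. X j \<omega>) / real m \<and> (\<Sum>j=1..m. X j \<omega>) / real m \<le> 2 * (a + e)"
proof -
  define T where "T = (\<lambda>k \<omega>. \<Sum>j=1..(2::nat)^k. X j \<omega> - a)"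
  have rv: "X j \<in> borel_measurable M" if "1 \<le> j" for j
    using ind that by (auto simp: indep_vars_def)
  have [measurable]: "T k \<in> borel_measurable M" for k
    unfolding T_def using rv by (intro borel_measurable_sum) auto
  have int: "integrable M (X j)" if "1 \<le> j" for j
    using sq[OF that] rv[OF that] by (auto intro: square_integrable_imp_integrable)
  have sqc: "integrable M (\<lambda>\<omega>. (X j \<omega> - a)\<^sup>2)" if "1 \<le> j" for j
    unfolding power2_diff using sq[OF that] int[OF that] by auto
  have T2: "integrable M (\<lambda>\<omega>. (T k \<omega>)\<^sup>2)" "expectation (\<lambda>\<omega>. (T k \<omega>)\<^sup>2) \<le> real (card {1..(2::nat)^k}) * C" for k
  proof -
    have "indep_vars (\<lambda>_. borel) X {1..(2::nat)^k}" by (rule indep_vars_subset[OF ind]) auto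
    then have i: "indep_vars (\<lambda>_. borel) (\<lambda>j \<omega>. X j \<omega> - a) {1..(2::nat)^k}"
      by (rule indep_vars_compose2) auto
    have "expectation (\<lambda>\<omega>. (X j \<omega> - a)\<^sup>2) \<le> C" if "1 \<le> j" for j
      using square_expectation_le(2)[OF rv[OF that] sq[OF that]] bound[OF that] mean[OF that] by simp
    then show "integrable M (\<lambda>\<omega>. (T k \<omega>)\<^sup>2)" "expectation (\<lambda>\<omega>. (T k \<omega>)\<^sup>2) \<le> real (card {1..(2::nat)^k}) * C"
      unfolding T_def using sqc int mean
      by (intro indep_vars_sum_second_moment[OF _ i]; force simp: prob_space)+
  qed
  define A where "A = (\<lambda>k. {\<omega> \<in> space M. (e * 2 ^ k)\<^sup>2 \<le> (T k \<omega>)\<^sup>2})"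
  have [measurable]: "A k \<in> sets M" for k unfolding A_def by measurable
  have PA: "measure M (A k) \<le> C / e\<^sup>2 * (1 / 2) ^ k" for k
  proof -
    have "measure M (A k) \<le> expectation (\<lambda>\<omega>. (T k \<omega>)\<^sup>2) / (e * 2 ^ k)\<^sup>2"
      unfolding A_def using T2(1) \<open>0 < e\<close> by (intro integral_Markov_inequality_measure[where A = "{}"]) auto
    also have "\<dots> \<le> 2 ^ k * C / (e * 2 ^ k)\<^sup>2"
      using T2(2)[of k] by (intro divide_right_mono) auto
    also have "\<dots> = C / e\<^sup>2 * (1 / 2) ^ k"
      using \<open>0 < e\<close> by (simp add: power2_eq_square power_divide)
    finally show ?thesis .
  qed
  have "summable (\<lambda>k. C / e\<^sup>2 * (1 / 2) ^ k :: real)" by (intro summable_mult summable_geometric) simp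
  then have "summable (\<lambda>k. measure M (A k))"
    by (rule summable_comparison_test'[where N = 0]) (simp only: real_norm_def abs_of_nonneg[OF measure_nonneg] PA)
  then have "AE \<omega> in M. \<forall>\<^sub>F k in sequentially. \<omega> \<in> space M - A k"
    by (intro borel_cantelli_AE1) (auto simp: emeasure_eq_measure)
  then show ?thesis
  proof eventually_elim
    case (elim \<omega>)
    then obtain K where K: "\<And>k. K \<le> k \<Longrightarrow> \<omega> \<in> space M - A k" by (auto simp: eventually_sequentially)
    define S where "S m = (\<Sum>j=1..m. X j \<omega>)" for m
    have S0: "0 \<le> S m" for m unfolding S_def using nonneg by (intro sum_nonneg) auto
    have S_mono: "S m \<le> S m'" if "m \<le> m'" for m m'
      unfolding S_def using that nonneg by (intro sum_mono2) auto
    have dyadic: "2 ^ k * (a - e) \<le> S (2 ^ k)" "S (2 ^ k) \<le> 2 ^ k * (a + e)" if "K \<le> k" for k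
    proof -
      have "(T k \<omega>)\<^sup>2 < (e * 2 ^ k)\<^sup>2" using K[OF that] by (auto simp: A_def)
      then have "\<bar>T k \<omega>\<bar> < e * 2 ^ k" using \<open>0 < e\<close> power2_less_imp_less[of "\<bar>T k \<omega>\<bar>" "e * 2 ^ k"] by simp
      moreover have "T k \<omega> = S (2 ^ k) - 2 ^ k * a" by (simp add: T_def S_def sum_subtractf)
      ultimately show "2 ^ k * (a - e) \<le> S (2 ^ k)" "S (2 ^ k) \<le> 2 ^ k * (a + e)"
        by (auto simp: algebra_simps)
    qed
    have a0: "0 \<le> a"
      using mean[of 1] nonneg[of 1] Bochner_Integration.integral_nonneg[of M "X 1"] by simp
    have "(a - e) / 2 \<le> S m / real m \<and> S m / real m \<le> 2 * (a + e)" if m: "2 ^ K \<le> m" for m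
    proof -
      have m1: "1 \<le> m" using m one_le_power[of "2::nat" K] by linarith
      then obtain k where k: "2 ^ k \<le> m" "m < 2 ^ (k + 1)" using ex_power_ivl1[of 2 m] by auto
      have "K < k + 1"
      proof (rule power_less_imp_less_exp[of "2::nat"])
        show "(2::nat) ^ K < 2 ^ (k + 1)" using m k by linarith
      qed simp
      then have kK: "K \<le> k" by simp
      have rk: "(2::real) ^ k \<le> real m" "real m < 2 * 2 ^ k"
        using k(1)[folded of_nat_le_iff[where 'a = real]] k(2)[folded of_nat_less_iff[where 'a = real]]
        by simp_all
      have "(a - e) / 2 * real m \<le> S m"
      proof (cases "a - e \<le> 0")
        case True
        then have "(a - e) / 2 * real m \<le> 0" by (intro mult_nonpos_nonneg) auto
        then show ?thesis using S0[of m] by linarith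
      next
        case False
        then have "(a - e) / 2 * real m \<le> (a - e) / 2 * (2 * 2 ^ k)"
          using rk by (intro mult_left_mono) auto
        also have "\<dots> \<le> S (2 ^ k)" using dyadic(1)[OF kK] by (simp add: mult.commute)
        also have "\<dots> \<le> S m" using k by (intro S_mono)
        finally show ?thesis .
      qed
      moreover have "S m \<le> 2 * (a + e) * real m"
      proof -
        have "S m \<le> S (2 ^ (k + 1))" using k by (intro S_mono) auto
        also have "\<dots> \<le> 2 * (a + e) * 2 ^ k" using dyadic(2)[of "k + 1"] kK by (simp add: algebra_simps)
        also have "\<dots> \<le> 2 * (a + e) * real m" using rk a0 \<open>0 < e\<close> by (intro mult_left_mono) auto
        finally show ?thesis .
      qed
      ultimately show ?thesis using m1 by (simp add: pos_le_divide_eq pos_divide_le_eq)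
    qed
    then show ?case unfolding eventually_sequentially S_def by blast
  qed
qed

section \<open>Averaging over the conditional law\<close>

lemma PiM_density:
  assumes "finite I" "prob_space P" and [measurable]: "w \<in> borel_measurable P"
    and "prob_space (density P w)"
  shows "PiM I (\<lambda>_. density P w) = density (PiM I (\<lambda>_. P)) (\<lambda>x. \<Prod>i\<in>I. w (x i))"
proof (rule sym)
  interpret P: product_sigma_finite "\<lambda>_. P"
    using assms(2) by (simp add: product_sigma_finite_def prob_space_imp_sigma_finite)
  interpret D: product_sigma_finite "\<lambda>_. density P w"
    using assms(4) by (simp add: product_sigma_finite_def prob_space_imp_sigma_finite)
  show "density (PiM I (\<lambda>_. P)) (\<lambda>x. \<Prod>i\<in>I. w (x i)) = PiM I (\<lambda>_. density P w)"
  proof (rule D.PiM_eqI[OF assms(1)])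
    show "sets (density (PiM I (\<lambda>_. P)) (\<lambda>x. \<Prod>i\<in>I. w (x i))) = sets (PiM I (\<lambda>_. density P w))"
      by (simp cong: sets_PiM_cong)
    fix C assume "\<And>i. i \<in> I \<Longrightarrow> C i \<in> sets (density P w)"
    then have C: "C i \<in> sets P" if "i \<in> I" for i using that by simp
    have "emeasure (density (PiM I (\<lambda>_. P)) (\<lambda>x. \<Prod>i\<in>I. w (x i))) (Pi\<^sub>E I C) =
        (\<integral>\<^sup>+x. (\<Prod>i\<in>I. w (x i)) * indicator (Pi\<^sub>E I C) x \<partial>PiM I (\<lambda>_. P))"
      using C assms(1) by (intro emeasure_density sets_PiM_I_finite) auto
    also have "\<dots> = (\<integral>\<^sup>+x. (\<Prod>i\<in>I. w (x i) * indicator (C i) (x i)) \<partial>PiM I (\<lambda>_. P))"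
    proof (rule nn_integral_cong)
      fix x assume "x \<in> space (PiM I (\<lambda>_. P))"
      then have "indicator (Pi\<^sub>E I C) x = (\<Prod>i\<in>I. indicator (C i) (x i) :: ennreal)"
        using assms(1) by (auto simp: indicator_def space_PiM PiE_iff prod_zero_iff)
      then show "(\<Prod>i\<in>I. w (x i)) * indicator (Pi\<^sub>E I C) x = (\<Prod>i\<in>I. w (x i) * indicator (C i) (x i))"
        by (simp add: prod.distrib)
    qed
    also have "\<dots> = (\<Prod>i\<in>I. \<integral>\<^sup>+x. w x * indicator (C i) x \<partial>P)"
      using C by (intro P.product_nn_integral_prod assms(1)) auto
    also have "\<dots> = (\<Prod>i\<in>I. emeasure (density P w) (C i))"
      using C by (intro prod.cong refl emeasure_density[symmetric]) auto
    finally show "emeasure (density (PiM I (\<lambda>_. P)) (\<lambda>x. \<Prod>i\<in>I. w (x i))) (Pi\<^sub>E I C) =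
        (\<Prod>i\<in>I. emeasure (density P w) (C i))" .
  qed
qed

text \<open>
  If the conditional law of \<open>Y\<close> depends on the conditioning \<open>\<sigma>\<close>-algebra through \<open>Z\<close> only, then
  it determines the law of \<open>(Z, Y)\<close>. The conditional law is required to have a density with
  respect to a fixed measure \<open>Q\<close>, so that its measurability in \<open>Z\<close> is that of the joint
  density \<open>W\<close>. Both measures agree on rectangles, by the defining property of the
  conditional expectation.
\<close>

lemma joint_law_of_cond_law:
  assumes "prob_space M" "subalgebra M H" and Z: "Z \<in> H \<rightarrow>\<^sub>M S1"
    and cond: "has_cond_law M H S Y K"
    and Q: "sigma_finite_measure Q" "sets Q = sets S"
    and W: "case_prod W \<in> borel_measurable (S1 \<Otimes>\<^sub>M Q)"
    and K: "\<And>\<omega>. \<omega> \<in> space M \<Longrightarrow> K \<omega> = density Q (W (Z \<omega>))"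
    and prob: "\<And>\<omega>. \<omega> \<in> space M \<Longrightarrow> prob_space (K \<omega>)"
  shows "distr M (S1 \<Otimes>\<^sub>M Q) (\<lambda>\<omega>. (Z \<omega>, Y \<omega>)) = density (distr M S1 Z \<Otimes>\<^sub>M Q) (case_prod W)"
proof -
  interpret prob_space M by fact
  interpret Q: sigma_finite_measure Q by fact
  interpret H: sigma_finite_subalgebra M H
  proof -
    interpret finite_measure_subalgebra M H by standard fact
    show "sigma_finite_subalgebra M H" by (rule sigma_finite_subalgebra_axioms)
  qed
  note [measurable] = W measurable_from_subalg[OF assms(2) Z]
  have Y [measurable]: "Y \<in> M \<rightarrow>\<^sub>M Q"
    using cond Q(2) by (simp add: has_cond_law_def cong: measurable_cong_sets)
  let ?E = "{C \<times> T | C T. C \<in> sets S1 \<and> T \<in> sets Q}"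
  let ?L = "distr M (S1 \<Otimes>\<^sub>M Q) (\<lambda>\<omega>. (Z \<omega>, Y \<omega>))" and ?R = "density (distr M S1 Z \<Otimes>\<^sub>M Q) (case_prod W)"
  have rect: "emeasure ?L (C \<times> T) = emeasure ?R (C \<times> T)" if C [measurable]: "C \<in> sets S1" and T [measurable]: "T \<in> sets Q" for C T
  proof -
    define f :: "_ \<Rightarrow> real" where "f = indicator (Z -` C \<inter> space H)"
    define g :: "_ \<Rightarrow> real" where "g = indicator (Y -` T \<inter> space M)"
    have sp: "space H = space M" using assms(2) by (simp add: subalgebra_def)
    have [measurable]: "f \<in> borel_measurable H" unfolding f_def using Z by measurable
    have [measurable]: "f \<in> borel_measurable M" unfolding f_def sp by measurable
    have [measurable]: "g \<in> borel_measurable M" unfolding g_def by measurable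
    have f0: "0 \<le> f \<omega>" for \<omega> by (simp add: f_def)
    have fg: "f \<omega> * g \<omega> = indicator ((\<lambda>\<omega>. (Z \<omega>, Y \<omega>)) -` (C \<times> T) \<inter> space M) \<omega>" for \<omega>
      by (auto simp: f_def g_def sp indicator_def)
    have int: "integrable M (\<lambda>\<omega>. f \<omega> * g \<omega>)"
      by (rule integrable_const_bound[where B = 1]) (auto simp: fg indicator_def)
    have AE: "AE \<omega> in M. real_cond_exp M H g \<omega> = measure (K \<omega>) T"
      using cond T Q(2) unfolding has_cond_law_def g_def by auto
    have "emeasure ?L (C \<times> T) = (\<integral>\<^sup>+\<omega>. ennreal (f \<omega> * g \<omega>) \<partial>M)"
      by (subst emeasure_distr) (auto simp: fg ennreal_indicator)
    also have "\<dots> = ennreal (\<integral>\<omega>. f \<omega> * g \<omega> \<partial>M)"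
      by (rule nn_integral_eq_integral[OF int]) (simp add: fg)
    also have "(\<integral>\<omega>. f \<omega> * g \<omega> \<partial>M) = (\<integral>\<omega>. f \<omega> * real_cond_exp M H g \<omega> \<partial>M)"
      by (rule H.real_cond_exp_intg(2)[OF int, symmetric]) measurable
    also have "ennreal \<dots> = (\<integral>\<^sup>+\<omega>. ennreal (f \<omega> * real_cond_exp M H g \<omega>) \<partial>M)"
    proof (rule nn_integral_eq_integral[symmetric])
      show "integrable M (\<lambda>\<omega>. f \<omega> * real_cond_exp M H g \<omega>)"
        by (rule H.real_cond_exp_intg(1)[OF int]) measurable
      show "AE \<omega> in M. 0 \<le> f \<omega> * real_cond_exp M H g \<omega>"
        using AE by eventually_elim (simp add: f0)
    qed
    also have "\<dots> = (\<integral>\<^sup>+\<omega>. indicator C (Z \<omega>) * emeasure (K \<omega>) T \<partial>M)"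
    proof (rule nn_integral_cong_AE)
      show "AE \<omega> in M. ennreal (f \<omega> * real_cond_exp M H g \<omega>) = indicator C (Z \<omega>) * emeasure (K \<omega>) T"
        using AE AE_space
      proof eventually_elim
        case (elim \<omega>)
        interpret K: prob_space "K \<omega>" using elim prob by auto
        show ?case using elim by (auto simp: f_def sp indicator_def K.emeasure_eq_measure)
      qed
    qed
    also have "\<dots> = (\<integral>\<^sup>+\<omega>. \<integral>\<^sup>+y. W (Z \<omega>) y * indicator (C \<times> T) (Z \<omega>, y) \<partial>Q \<partial>M)"
    proof (rule nn_integral_cong)
      fix \<omega> assume \<omega>: "\<omega> \<in> space M"
      then have [measurable]: "Z \<omega> \<in> space S1" by (auto intro: measurable_space)
      have "emeasure (K \<omega>) T = (\<integral>\<^sup>+y. W (Z \<omega>) y * indicator T y \<partial>Q)"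
        unfolding K[OF \<omega>] by (rule emeasure_density) measurable
      then show "indicator C (Z \<omega>) * emeasure (K \<omega>) T = (\<integral>\<^sup>+y. W (Z \<omega>) y * indicator (C \<times> T) (Z \<omega>, y) \<partial>Q)"
        by (cases "Z \<omega> \<in> C") (auto simp: indicator_def)
    qed
    also have "\<dots> = (\<integral>\<^sup>+z. \<integral>\<^sup>+y. W z y * indicator (C \<times> T) (z, y) \<partial>Q \<partial>distr M S1 Z)"
      by (rule nn_integral_distr[symmetric]) measurable
    also have "\<dots> = (\<integral>\<^sup>+x. case_prod W x * indicator (C \<times> T) x \<partial>(distr M S1 Z \<Otimes>\<^sub>M Q))"
      by (subst Q.nn_integral_fst[symmetric]) (auto simp: case_prod_beta)
    also have "\<dots> = emeasure ?R (C \<times> T)"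
      by (rule emeasure_density[symmetric]) measurable
    finally show ?thesis .
  qed
  show ?thesis
  proof (rule measure_eqI_generator_eq[where E = ?E and \<Omega> = "space S1 \<times> space Q" and A = "\<lambda>_. space S1 \<times> space Q"])
    show "Int_stable ?E"
      by (rule Int_stable_pair_measure_generator)
    show "?E \<subseteq> Pow (space S1 \<times> space Q)"
      by (rule pair_measure_closed)
    show "sets ?L = sigma_sets (space S1 \<times> space Q) ?E" "sets ?R = sigma_sets (space S1 \<times> space Q) ?E"
      by (simp_all add: sets_pair_measure)
    show "emeasure ?L (space S1 \<times> space Q) \<noteq> \<infinity>"
      using prob_space.emeasure_space_1[OF prob_space_distr, of "\<lambda>\<omega>. (Z \<omega>, Y \<omega>)" "S1 \<Otimes>\<^sub>M Q"]
      by (simp add: space_pair_measure)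
  qed (use rect in auto)
qed

text \<open>
  Integrating the joint density over the second variable first gives the conditional probabilities,
  in which \<open>Z\<close> is frozen.
\<close>

lemma measure_le_of_cond_law:
  assumes "prob_space M" "subalgebra M H" and Z: "Z \<in> H \<rightarrow>\<^sub>M S1"
    and cond: "has_cond_law M H S Y K"
    and Q: "sigma_finite_measure Q" "sets Q = sets S"
    and W: "case_prod W \<in> borel_measurable (S1 \<Otimes>\<^sub>M Q)"
    and K: "\<And>\<omega>. \<omega> \<in> space M \<Longrightarrow> K \<omega> = density Q (W (Z \<omega>))"
    and prob: "\<And>\<omega>. \<omega> \<in> space M \<Longrightarrow> prob_space (K \<omega>)"
    and D [measurable]: "D \<in> sets (S1 \<Otimes>\<^sub>M Q)"
    and bound: "\<And>\<omega>. \<omega> \<in> space M \<Longrightarrow> measure (K \<omega>) {y \<in> space Q. (Z \<omega>, y) \<in> D} \<le> b"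
  shows "{\<omega> \<in> space M. (Z \<omega>, Y \<omega>) \<in> D} \<in> sets M"
    and "measure M {\<omega> \<in> space M. (Z \<omega>, Y \<omega>) \<in> D} \<le> b"
proof -
  interpret prob_space M by fact
  interpret Q: sigma_finite_measure Q by fact
  note [measurable] = W measurable_from_subalg[OF assms(2) Z]
  have Y [measurable]: "Y \<in> M \<rightarrow>\<^sub>M Q"
    using cond Q(2) by (simp add: has_cond_law_def cong: measurable_cong_sets)
  show "{\<omega> \<in> space M. (Z \<omega>, Y \<omega>) \<in> D} \<in> sets M" by measurable
  have joint: "distr M (S1 \<Otimes>\<^sub>M Q) (\<lambda>\<omega>. (Z \<omega>, Y \<omega>)) = density (distr M S1 Z \<Otimes>\<^sub>M Q) (case_prod W)"
    by (rule joint_law_of_cond_law) fact+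
  have "emeasure M {\<omega> \<in> space M. (Z \<omega>, Y \<omega>) \<in> D} =
      emeasure (distr M (S1 \<Otimes>\<^sub>M Q) (\<lambda>\<omega>. (Z \<omega>, Y \<omega>))) D"
    by (subst emeasure_distr) (auto intro!: arg_cong2[where f = emeasure])
  also have "\<dots> = (\<integral>\<^sup>+x. case_prod W x * indicator D x \<partial>(distr M S1 Z \<Otimes>\<^sub>M Q))"
    unfolding joint by (rule emeasure_density) measurable
  also have "\<dots> = (\<integral>\<^sup>+z. \<integral>\<^sup>+y. W z y * indicator D (z, y) \<partial>Q \<partial>distr M S1 Z)"
    by (subst Q.nn_integral_fst[symmetric]) (auto simp: case_prod_beta)
  also have "\<dots> = (\<integral>\<^sup>+\<omega>. \<integral>\<^sup>+y. W (Z \<omega>) y * indicator D (Z \<omega>, y) \<partial>Q \<partial>M)"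
    by (rule nn_integral_distr) measurable
  also have "\<dots> \<le> (\<integral>\<^sup>+\<omega>. ennreal b \<partial>M)"
  proof (rule nn_integral_mono)
    fix \<omega> assume \<omega>: "\<omega> \<in> space M"
    then have [measurable]: "Z \<omega> \<in> space S1" by (auto intro: measurable_space)
    interpret K: prob_space "K \<omega>" by (rule prob[OF \<omega>])
    have "(\<integral>\<^sup>+y. W (Z \<omega>) y * indicator D (Z \<omega>, y) \<partial>Q) =
        (\<integral>\<^sup>+y. W (Z \<omega>) y * indicator {y \<in> space Q. (Z \<omega>, y) \<in> D} y \<partial>Q)"
      by (rule nn_integral_cong) (auto simp: indicator_def)
    also have "\<dots> = emeasure (K \<omega>) {y \<in> space Q. (Z \<omega>, y) \<in> D}"
      unfolding K[OF \<omega>] by (rule emeasure_density[symmetric]) measurable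
    also have "\<dots> \<le> ennreal b"
      using bound[OF \<omega>] by (simp add: K.emeasure_eq_measure ennreal_leI)
    finally show "(\<integral>\<^sup>+y. W (Z \<omega>) y * indicator D (Z \<omega>, y) \<partial>Q) \<le> ennreal b" .
  qed
  also have "\<dots> = ennreal b" by (simp add: emeasure_space_1)
  finally have "ennreal (measure M {\<omega> \<in> space M. (Z \<omega>, Y \<omega>) \<in> D}) \<le> ennreal b"
    by (simp add: emeasure_eq_measure)
  moreover have "0 \<le> b"
    using not_empty bound order_trans[OF measure_nonneg] by blast
  ultimately show "measure M {\<omega> \<in> space M. (Z \<omega>, Y \<omega>) \<in> D} \<le> b" by simp
qed

section \<open>Measurability of the minimizer\<close>

text \<open>
  Over a compact set \<open>K\<close> a continuous function attains its infimum, hence it has a global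
  minimizer in \<open>K\<close> iff its infimum over \<open>K\<close> does not exceed its infimum over \<open>U\<close>. Both infima may
  be taken over countable dense subsets. An open set is a countable union of such \<open>K\<close>.
\<close>

lemma sets_arg_min_in_open:
  fixes v :: "'w \<Rightarrow> 'a::euclidean_space \<Rightarrow> real"
  assumes U: "open U" and V: "open V"
    and [measurable]: "\<And>x. x \<in> U \<Longrightarrow> (\<lambda>\<omega>. v \<omega> x) \<in> borel_measurable H"
    and cont: "\<And>\<omega>. \<omega> \<in> space H \<Longrightarrow> continuous_on U (v \<omega>)"
  shows "{\<omega> \<in> space H. \<exists>x\<in>V. is_arg_min (v \<omega>) (\<lambda>x. x \<in> U) x} \<in> sets H"
proof -
  obtain D where D: "countable D" "D \<subseteq> Pow (V \<inter> U)" "\<And>K. K \<in> D \<Longrightarrow> \<exists>a b. K = cbox a b" "\<Union>D = V \<inter> U"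
    using open_countable_Union_open_cbox[OF open_Int[OF V U]] by metis
  obtain DU where DU: "countable DU" "DU \<subseteq> U" "U \<subseteq> closure DU" using separable by metis
  have near: "\<exists>x'\<in>T. \<bar>v \<omega> x' - v \<omega> x\<bar> < e"
    if near: "\<omega> \<in> space H" "x \<in> U" "T \<subseteq> U" "x \<in> closure T" "0 < e" for \<omega> x T and e :: real
  proof -
    obtain d where "0 < d" "\<And>x'. x' \<in> U \<Longrightarrow> dist x' x < d \<Longrightarrow> dist (v \<omega> x') (v \<omega> x) < e"
      using cont[OF near(1)] near(2,5) unfolding continuous_on_iff by metis
    moreover obtain x' where "x' \<in> T" "dist x' x < d"
      using near(4) \<open>0 < d\<close> by (auto simp: closure_approachable)
    ultimately show ?thesis using near(3) by (auto simp: dist_real_def intro!: bexI[of _ x'])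
  qed
  have *: "{\<omega> \<in> space H. \<exists>x\<in>K. is_arg_min (v \<omega>) (\<lambda>x. x \<in> U) x} \<in> sets H" if "K \<in> D" for K
  proof (cases "K = {}")
    case False
    have K: "compact K" "K \<subseteq> U" using D(2) D(3)[OF that] that by (auto simp: compact_cbox)
    obtain DK where DK: "countable DK" "DK \<subseteq> K" "K \<subseteq> closure DK" using separable by metis
    have "(\<exists>x\<in>K. is_arg_min (v \<omega>) (\<lambda>x. x \<in> U) x) \<longleftrightarrow>
        (\<forall>y\<in>DU. \<forall>k. \<exists>x\<in>DK. v \<omega> x < v \<omega> y + 1 / real (Suc k))" (is "?l \<longleftrightarrow> ?r")
      if \<omega>: "\<omega> \<in> space H" for \<omega>
    proof
      assume ?l
      then obtain x where x: "x \<in> K" "\<And>y. y \<in> U \<Longrightarrow> v \<omega> x \<le> v \<omega> y"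
        by (auto simp: is_arg_min_def not_less)
      show ?r
      proof (intro ballI allI)
        fix y k assume "y \<in> DU"
        have "DK \<subseteq> U" "x \<in> U" "x \<in> closure DK" "0 < 1 / real (Suc k)" using x(1) K(2) DK by auto
        from near[OF \<omega> this(2,1,3,4)]
        obtain x' where "x' \<in> DK" "\<bar>v \<omega> x' - v \<omega> x\<bar> < 1 / real (Suc k)" by blast
        then show "\<exists>x\<in>DK. v \<omega> x < v \<omega> y + 1 / real (Suc k)"
          using x(2)[of y] \<open>y \<in> DU\<close> DU(2) by (intro bexI[of _ x']) auto
      qed
    next
      assume r: ?r
      obtain x where x: "x \<in> K" "\<And>x'. x' \<in> K \<Longrightarrow> v \<omega> x \<le> v \<omega> x'"
        using continuous_attains_inf[OF K(1) False continuous_on_subset[OF cont[OF \<omega>] K(2)]] by auto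
      have le: "v \<omega> x \<le> v \<omega> y" if y: "y \<in> DU" for y
      proof (rule ccontr)
        assume "\<not> ?thesis"
        then obtain k where "inverse (real (Suc k)) < v \<omega> x - v \<omega> y"
          using reals_Archimedean[of "v \<omega> x - v \<omega> y"] by (auto simp: not_le)
        moreover obtain x' where "x' \<in> DK" "v \<omega> x' < v \<omega> y + 1 / real (Suc k)" using r y by blast
        moreover have "v \<omega> x \<le> v \<omega> x'" by (rule x(2)) (rule subsetD[OF DK(2) \<open>x' \<in> DK\<close>])
        ultimately show False unfolding inverse_eq_divide by linarith
      qed
      have "v \<omega> x \<le> v \<omega> y" if y: "y \<in> U" for y
      proof (rule ccontr)
        assume "\<not> ?thesis"
        then have "0 < v \<omega> x - v \<omega> y" by simp
        from near[OF \<omega> y DU(2) subsetD[OF DU(3) y] this]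
        obtain y' where "y' \<in> DU" "\<bar>v \<omega> y' - v \<omega> y\<bar> < v \<omega> x - v \<omega> y" by blast
        then show False using le[of y'] by auto
      qed
      then have "is_arg_min (v \<omega>) (\<lambda>x. x \<in> U) x"
        using x(1) K(2) unfolding is_arg_min_def by (meson not_less subsetD)
      then show ?l using x(1) by blast
    qed
    then have eq: "{\<omega> \<in> space H. \<exists>x\<in>K. is_arg_min (v \<omega>) (\<lambda>x. x \<in> U) x} =
        {\<omega> \<in> space H. \<forall>y\<in>DU. \<forall>k. \<exists>x\<in>DK. v \<omega> x < v \<omega> y + 1 / real (Suc k)}" by auto
    have "{\<omega> \<in> space H. v \<omega> x < v \<omega> y + 1 / real (Suc k)} \<in> sets H" if "y \<in> DU" "x \<in> DK" for x y k
    proof -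
      have [measurable]: "(\<lambda>\<omega>. v \<omega> x) \<in> borel_measurable H" "(\<lambda>\<omega>. v \<omega> y) \<in> borel_measurable H"
        using that DU(2) DK(2) K(2) assms(3) by auto
      show ?thesis by measurable
    qed
    then show ?thesis
      unfolding eq using DU(1) DK(1)
      by (intro sets.sets_Collect_countable_All' sets.sets_Collect_countable_All
          sets.sets_Collect_countable_Ex')
  qed simp
  have "{\<omega> \<in> space H. \<exists>x\<in>V. is_arg_min (v \<omega>) (\<lambda>x. x \<in> U) x} =
      (\<Union>K\<in>D. {\<omega> \<in> space H. \<exists>x\<in>K. is_arg_min (v \<omega>) (\<lambda>x. x \<in> U) x})" (is "?A = ?B")
  proof (intro set_eqI iffI)
    fix \<omega> assume "\<omega> \<in> ?A"
    then obtain x where "\<omega> \<in> space H" "x \<in> V" "is_arg_min (v \<omega>) (\<lambda>x. x \<in> U) x" by auto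
    moreover then have "x \<in> \<Union>D" unfolding D(4) by (simp add: is_arg_min_def)
    ultimately show "\<omega> \<in> ?B" by auto
  next
    fix \<omega> assume "\<omega> \<in> ?B"
    then show "\<omega> \<in> ?A" using D(2) by blast
  qed
  also have "\<dots> \<in> sets H" using D(1) * by (intro sets.countable_UN') auto
  finally show ?thesis .
qed

text \<open>
  With \<open>\<B>\<close> a countable basis, there are two different minimizers iff there are minimizers in two
  disjoint members of \<open>\<B>\<close>. Hence the event that the minimizer is unique is measurable, and on this
  event the minimizer lies in an open set \<open>V\<close> iff there is a minimizer in \<open>V\<close>.
\<close>

lemma measurable_unique_arg_min:
  fixes v :: "'w \<Rightarrow> 'a::euclidean_space \<Rightarrow> real"
  assumes U: "open U"
    and meas: "\<And>x. x \<in> U \<Longrightarrow> (\<lambda>\<omega>. v \<omega> x) \<in> borel_measurable H"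
    and cont: "\<And>\<omega>. \<omega> \<in> space H \<Longrightarrow> continuous_on U (v \<omega>)"
  shows "(\<lambda>\<omega>. if \<exists>!x. is_arg_min (v \<omega>) (\<lambda>x. x \<in> U) x then arg_min (v \<omega>) (\<lambda>x. x \<in> U) else x0)
    \<in> borel_measurable H"
proof -
  define P where "P \<omega> = is_arg_min (v \<omega>) (\<lambda>x. x \<in> U)" for \<omega>
  have in_open [measurable]: "{\<omega> \<in> space H. \<exists>x\<in>V. P \<omega> x} \<in> sets H" if "open V" for V
    unfolding P_def using sets_arg_min_in_open[OF U that meas cont] .
  obtain \<B> :: "'a set set" where \<B>: "countable \<B>" "topological_basis \<B>"
    using ex_countable_basis by auto
  let ?two = "\<Union>V\<in>\<B>. \<Union>W\<in>{W\<in>\<B>. V \<inter> W = {}}.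
    {\<omega> \<in> space H. \<exists>x\<in>V. P \<omega> x} \<inter> {\<omega> \<in> space H. \<exists>x\<in>W. P \<omega> x}"
  \<comment> \<open>the event that there are at least two minimizers\<close>
  have two: "?two \<in> sets H"
    using \<B> by (intro sets.countable_UN' countable_subset[OF _ \<B>(1)])
      (auto intro!: sets.Int in_open simp: topological_basis_open)
  have unique: "{\<omega> \<in> space H. \<exists>!x. P \<omega> x} = {\<omega> \<in> space H. \<exists>x\<in>UNIV. P \<omega> x} - ?two"
  proof (intro set_eqI iffI)
    fix \<omega> assume "\<omega> \<in> {\<omega> \<in> space H. \<exists>!x. P \<omega> x}"
    then show "\<omega> \<in> {\<omega> \<in> space H. \<exists>x\<in>UNIV. P \<omega> x} - ?two" by auto
  next
    fix \<omega> assume \<omega>: "\<omega> \<in> {\<omega> \<in> space H. \<exists>x\<in>UNIV. P \<omega> x} - ?two"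
    have "x = y" if "P \<omega> x" "P \<omega> y" for x y
    proof (rule ccontr)
      assume "x \<noteq> y"
      then obtain V W where VW: "open V" "open W" "x \<in> V" "y \<in> W" "V \<inter> W = {}"
        using hausdorff by metis
      obtain V' where "V' \<in> \<B>" "x \<in> V'" "V' \<subseteq> V" using topological_basisE[OF \<B>(2) VW(1,3)] by metis
      moreover obtain W' where "W' \<in> \<B>" "y \<in> W'" "W' \<subseteq> W" using topological_basisE[OF \<B>(2) VW(2,4)] by metis
      ultimately have "\<omega> \<in> ?two"
        using \<omega> that VW(5) by (intro UN_I[of V'] UN_I[of W']) auto
      then show False using \<omega> by auto
    qed
    then show "\<omega> \<in> {\<omega> \<in> space H. \<exists>!x. P \<omega> x}" using \<omega> by auto
  qed
  have uniq [measurable]: "{\<omega> \<in> space H. \<exists>!x. P \<omega> x} \<in> sets H"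
    unfolding unique using two in_open[of UNIV] by auto
  have arg: "P \<omega> (arg_min (v \<omega>) (\<lambda>x. x \<in> U))" if "\<exists>!x. P \<omega> x" for \<omega>
    using that unfolding P_def arg_min_def by (metis someI_ex)
  show ?thesis
  proof (rule borel_measurableI)
    fix V :: "'a set" assume V: "open V"
    have "(\<lambda>\<omega>. if \<exists>!x. is_arg_min (v \<omega>) (\<lambda>x. x \<in> U) x then arg_min (v \<omega>) (\<lambda>x. x \<in> U) else x0) -` V \<inter> space H =
        ({\<omega> \<in> space H. \<exists>!x. P \<omega> x} \<inter> {\<omega> \<in> space H. \<exists>x\<in>V. P \<omega> x}) \<union>
        (if x0 \<in> V then space H - {\<omega> \<in> space H. \<exists>!x. P \<omega> x} else {})"
      using arg by (auto simp: P_def[symmetric]) metis+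
    also have "\<dots> \<in> sets H" using in_open[OF V] by auto
    finally show "(\<lambda>\<omega>. if \<exists>!x. is_arg_min (v \<omega>) (\<lambda>x. x \<in> U) x then arg_min (v \<omega>) (\<lambda>x. x \<in> U) else x0) -` V
        \<inter> space H \<in> sets H" .
  qed
qed

lemma open_admissible: "open {x :: (real ^ 'e) \<times> (real ^ 'q). admissible x}"
proof -
  have "{x :: (real ^ 'e) \<times> (real ^ 'q). admissible x} = (\<Inter>i\<in>UNIV. {x. 0 < snd x $ i})"
    by (auto simp: admissible_def pos_vec_def)
  then show ?thesis
    by (auto intro!: open_INT open_Collect_less continuous_intros)
qed

lemma minimizer_admissible:
  assumes "admissible x0"
  shows "admissible (minimizer f \<mu> A B x0 s m)"
    and "v_fun f \<mu> A B s m (minimizer f \<mu> A B x0 s m) \<le> v_fun f \<mu> A B s m x0"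
proof -
  have "admissible (minimizer f \<mu> A B x0 s m) \<and>
      v_fun f \<mu> A B s m (minimizer f \<mu> A B x0 s m) \<le> v_fun f \<mu> A B s m x0"
  proof (cases "\<exists>!x. is_arg_min (v_fun f \<mu> A B s m) admissible x")
    case True
    then have "is_arg_min (v_fun f \<mu> A B s m) admissible (minimizer f \<mu> A B x0 s m)"
      unfolding minimizer_def arg_min_def by (auto intro: someI2_ex)
    then show ?thesis using assms unfolding is_arg_min_def by (meson not_less)
  qed (simp add: minimizer_def assms)
  then show "admissible (minimizer f \<mu> A B x0 s m)"
    and "v_fun f \<mu> A B s m (minimizer f \<mu> A B x0 s m) \<le> v_fun f \<mu> A B s m x0" by auto
qed

lemma measurable_first_stage:
  assumes "1 \<le> j"
    and "\<And>j. 1 \<le> j \<Longrightarrow> X j \<in> M \<rightarrow>\<^sub>M sample_space"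
  shows "X j \<in> first_stage_algebra M X \<rightarrow>\<^sub>M sample_space"
proof -
  have "(\<lambda>\<omega>. \<lambda>j\<in>{1..}. X j \<omega>) \<in> space M \<rightarrow> space (PiM {1..} (\<lambda>_. sample_space))"
    by (auto simp: space_PiM space_pair_measure)
  then have "(\<lambda>\<omega>. \<lambda>j\<in>{1..}. X j \<omega>) \<in> first_stage_algebra M X \<rightarrow>\<^sub>M PiM {1..} (\<lambda>_. sample_space)"
    unfolding first_stage_algebra_def by (rule measurable_vimage_algebra1)
  from measurable_compose[OF this measurable_component_singleton[of j]] assms(1)
  show ?thesis by simp
qed

lemma subalgebra_first_stage:
  assumes "\<And>j. 1 \<le> j \<Longrightarrow> X j \<in> M \<rightarrow>\<^sub>M sample_space"
  shows "subalgebra M (first_stage_algebra M X)"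
proof -
  have [measurable]: "(\<lambda>\<omega>. \<lambda>j\<in>{1..}. X j \<omega>) \<in> M \<rightarrow>\<^sub>M PiM {1..} (\<lambda>_. sample_space)"
    using assms by (intro measurable_restrict) auto
  then show ?thesis
    unfolding measurable_iff_sets by (simp add: subalgebra_def first_stage_algebra_def)
qed

lemma continuous_on_F_fun:
  assumes "continuous_on S a" "continuous_on S b" "\<And>x i. x \<in> S \<Longrightarrow> b x $ i \<noteq> 0"
  shows "continuous_on S (\<lambda>x. F_fun f \<mu> g (a x) n (b x))"
  unfolding F_fun_def using assms(3) by (intro continuous_intros assms(1,2)) auto

lemma measurable_minimizer:
  fixes f :: "(real ^ 'd) \<times> (nat ^ 'p) \<Rightarrow> real" and A :: "real ^ 'e ^ 'd" and B :: "real ^ 'q ^ 'p"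
  assumes [measurable]: "f \<in> borel_measurable sample_space"
    and B: "\<forall>l. pos_vec l \<longrightarrow> pos_vec (B *v l)"
    and X: "\<And>j. 1 \<le> j \<Longrightarrow> X j \<in> M \<rightarrow>\<^sub>M sample_space"
  shows "(\<lambda>\<omega>. minimizer f \<mu> A B x0 (\<lambda>j. X j \<omega>) m) \<in> borel_measurable (first_stage_algebra M X)"
proof -
  let ?H = "first_stage_algebra M X"
  let ?v = "\<lambda>\<omega>. v_fun f \<mu> A B (\<lambda>j. X j \<omega>) m"
  have [measurable]: "X j \<in> ?H \<rightarrow>\<^sub>M sample_space" if "j \<in> {1..m}" for j
    using measurable_first_stage[of j X M, OF _ X] that by auto
  have [measurable]: "(\<lambda>\<omega>. snd (X j \<omega>) $ i) \<in> ?H \<rightarrow>\<^sub>M count_space UNIV" if "j \<in> {1..m}" for i j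
  proof -
    have "(\<lambda>\<omega>. snd (X j \<omega>)) \<in> ?H \<rightarrow>\<^sub>M count_space UNIV" using that by measurable
    from measurable_compose[OF this, of "\<lambda>n. n $ i"] show ?thesis by simp
  qed
  have meas: "(\<lambda>\<omega>. ?v \<omega> x) \<in> borel_measurable ?H" for x
    unfolding v_fun_def F_fun_def case_prod_beta by measurable
  have cont: "continuous_on {x. admissible x} (?v \<omega>)" for \<omega>
  proof -
    have "(B *v snd x) $ i \<noteq> 0" if "admissible x" for x and i
      using B that by (auto simp: admissible_def pos_vec_def less_imp_neq[THEN not_sym])
    moreover have "continuous_on {x. admissible x} (\<lambda>x. A *v fst x)"
      "continuous_on {x. admissible x} (\<lambda>x. B *v snd x)"
      by (rule continuous_on_compose2[OF matrix_vector_mult_linear_continuous_on _ subset_UNIV],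
          intro continuous_intros)+
    ultimately have "continuous_on {x. admissible x}
        (\<lambda>x. F_fun f \<mu> (fst (X j \<omega>)) (A *v fst x) (snd (X j \<omega>)) (B *v snd x))" for j
      by (intro continuous_on_F_fun) auto
    then show ?thesis
      unfolding v_fun_def case_prod_beta by (intro continuous_intros)
  qed
  from measurable_unique_arg_min[OF open_admissible meas cont, of x0]
  show ?thesis unfolding minimizer_def by (simp only: mem_Collect_eq)
qed

section \<open>The estimators in natural parameters\<close>

definition nat_param :: "real ^ 'p \<Rightarrow> real ^ 'd \<Rightarrow> real ^ 'p \<Rightarrow> (real ^ 'd) \<times> (real ^ 'p)" where
  "nat_param \<mu> \<theta> l = (\<theta>, \<chi> i. ln (l $ i / \<mu> $ i))"

lemma tilted_rate_nat_param:
  assumes "pos_vec \<mu>" "pos_vec l"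
  shows "tilted_rate \<mu> (snd (nat_param \<mu> \<theta> l)) = l"
  using assms by (simp add: tilted_rate_def nat_param_def vec_eq_iff pos_vec_def less_imp_neq[THEN not_sym])

lemma inverse_tilt_nat_param:
  fixes g \<theta> :: "real ^ 'd" and n :: "nat ^ 'p"
  assumes "pos_vec \<mu>" "pos_vec l"
  shows "1 / tilt \<mu> (nat_param \<mu> \<theta> l) (g, n) =
    exp (- (\<theta> \<bullet> g) + (norm \<theta>)\<^sup>2 / 2) * (\<Prod>i\<in>UNIV. exp (l $ i - \<mu> $ i) * (\<mu> $ i / l $ i) ^ (n $ i))"
proof -
  have pos: "0 < \<mu> $ i" "0 < l $ i" for i using assms by (auto simp: pos_vec_def)
  have factor: "exp (l $ i - \<mu> $ i) * (\<mu> $ i / l $ i) ^ (n $ i) =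
      exp (\<mu> $ i * (exp (ln (l $ i / \<mu> $ i)) - 1) - real (n $ i) * ln (l $ i / \<mu> $ i))" for i
  proof -
    have "(\<mu> $ i / l $ i) ^ (n $ i) = exp (- (real (n $ i) * ln (l $ i / \<mu> $ i)))"
      using pos[of i] by (simp add: exp_minus exp_of_nat_mult power_divide)
    moreover have "\<mu> $ i * (exp (ln (l $ i / \<mu> $ i)) - 1) = l $ i - \<mu> $ i"
      using pos[of i] by (simp add: field_simps)
    ultimately show ?thesis by (simp add: exp_diff exp_minus divide_inverse)
  qed
  let ?z = "nat_param \<mu> \<theta> l"
  have "1 / tilt \<mu> ?z (g, n) = exp (cumulant \<mu> ?z - pairing ?z (g, n))"
    by (simp add: tilt_def exp_diff)
  also have "cumulant \<mu> ?z - pairing ?z (g, n) = (- (\<theta> \<bullet> g) + (norm \<theta>)\<^sup>2 / 2) +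
      (\<Sum>i\<in>UNIV. \<mu> $ i * (exp (ln (l $ i / \<mu> $ i)) - 1) - real (n $ i) * ln (l $ i / \<mu> $ i))"
    by (simp add: cumulant_def pairing_def nat_param_def sum_subtractf)
  finally show ?thesis by (simp only: exp_add exp_sum[OF finite] factor)
qed

lemma F_fun_nat_param:
  assumes "pos_vec \<mu>" "pos_vec l"
  shows "F_fun f \<mu> g \<theta> n l = (f (g, n))\<^sup>2 / tilt \<mu> (nat_param \<mu> \<theta> l) (g, n)"
  unfolding F_fun_def mult.assoc inverse_tilt_nat_param[OF assms, symmetric] by simp

text \<open>
  A summand of the estimator: with \<open>y'\<close> the point \<open>y\<close> after the shift, it is \<open>f / tilt\<close> at \<open>y'\<close>,
  where \<open>y'\<close> has the density \<open>tilt\<close> with respect to the original law.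
\<close>

definition shifted_weight ::
  "((real ^ 'd) \<times> (nat ^ 'p) \<Rightarrow> real) \<Rightarrow> real ^ 'p \<Rightarrow> (real ^ 'd) \<times> (real ^ 'p) \<Rightarrow>
   (real ^ 'd) \<times> (nat ^ 'p) \<Rightarrow> real" where
  "shifted_weight f \<mu> z y = f (fst y + fst z, snd y) / tilt \<mu> z (fst y + fst z, snd y)"

lemma importance_estimator_nat_param:
  assumes "pos_vec \<mu>" "pos_vec l"
  shows "importance_estimator f \<mu> \<theta> l n t =
    (1 / real n) * (\<Sum>j=1..n. shifted_weight f \<mu> (nat_param \<mu> \<theta> l) (t j))"
proof -
  have "exp (- (\<theta> \<bullet> g) - (norm \<theta>)\<^sup>2 / 2) = exp (- (\<theta> \<bullet> (g + \<theta>)) + (norm \<theta>)\<^sup>2 / 2)" for g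
    by (simp add: inner_add_right power2_norm_eq_inner)
  then have "f (g + \<theta>, k) * exp (- (\<theta> \<bullet> g) - (norm \<theta>)\<^sup>2 / 2) *
      (\<Prod>i\<in>UNIV. exp (l $ i - \<mu> $ i) * (\<mu> $ i / l $ i) ^ (k $ i)) =
      f (g + \<theta>, k) * (1 / tilt \<mu> (nat_param \<mu> \<theta> l) (g + \<theta>, k))" for g k
    by (simp only: inverse_tilt_nat_param[OF assms] mult.assoc)
  then show ?thesis
    unfolding importance_estimator_def shifted_weight_def by (simp add: nat_param_def)
qed

lemma borel_measurable_shifted_weight [measurable]:
  assumes [measurable]: "f \<in> borel_measurable sample_space"
  shows "(\<lambda>(z, y). shifted_weight f \<mu> z y) \<in> borel_measurable (borel \<Otimes>\<^sub>M sample_space)"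
proof -
  let ?N = "(borel :: ((real ^ 'd) \<times> (real ^ 'p)) measure) \<Otimes>\<^sub>M (sample_space :: ((real ^ 'd) \<times> (nat ^ 'p)) measure)"
  have [measurable]: "fst \<in> borel_measurable (borel :: ((real ^ 'd) \<times> (real ^ 'p)) measure)"
    by (intro borel_measurable_continuous_onI continuous_intros)
  have s [measurable]: "(\<lambda>x. (fst (snd x) + fst (fst x), snd (snd x))) \<in> ?N \<rightarrow>\<^sub>M sample_space"
    by measurable
  have "(\<lambda>x. f (fst (snd x) + fst (fst x), snd (snd x))) \<in> borel_measurable ?N"
    by (rule measurable_compose[OF s]) measurable
  moreover have "(\<lambda>x. (fst x, (fst (snd x) + fst (fst x), snd (snd x)))) \<in> ?N \<rightarrow>\<^sub>M ?N"
    by measurable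
  from measurable_compose[OF this borel_measurable_tilt[of \<mu>]]
  have "(\<lambda>x. tilt \<mu> (fst x) (fst (snd x) + fst (fst x), snd (snd x))) \<in> borel_measurable ?N"
    by simp
  ultimately show ?thesis unfolding shifted_weight_def case_prod_beta by measurable
qed

lemma borel_measurable_shifted_weight_right [measurable]:
  assumes "f \<in> borel_measurable sample_space"
  shows "shifted_weight f \<mu> z \<in> borel_measurable sample_space"
proof -
  have "(\<lambda>y. (z, y)) \<in> sample_space \<rightarrow>\<^sub>M borel \<Otimes>\<^sub>M sample_space" by measurable
  from measurable_compose[OF this borel_measurable_shifted_weight[OF assms]] show ?thesis by simp
qed

text \<open>
  Under the law of the second stage sample, the mean of the weighted function is the original
  mean, and each further power of it costs a negative power of \<open>tilt\<close>.
\<close>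

lemma moments_shifted_weight:
  fixes f :: "(real ^ 'd) \<times> (nat ^ 'p) \<Rightarrow> real" and z :: "(real ^ 'd) \<times> (real ^ 'p)"
  assumes "pos_vec \<mu>" and f [measurable]: "f \<in> borel_measurable sample_space"
  defines "P \<equiv> normal_poisson (tilted_rate \<mu> (snd z)) :: ((real ^ 'd) \<times> (nat ^ 'p)) measure"
  shows "(\<integral>y. shifted_weight f \<mu> z y \<partial>P) = (\<integral>y. f y \<partial>normal_poisson \<mu>)"
    and "integrable P (\<lambda>y. shifted_weight f \<mu> z y ^ 4) \<longleftrightarrow>
      integrable (normal_poisson \<mu>) (\<lambda>y. f y ^ 4 * tilt \<mu> z y powr (- 3))"
    and "(\<integral>y. shifted_weight f \<mu> z y ^ 4 \<partial>P) = (\<integral>y. f y ^ 4 * tilt \<mu> z y powr (- 3) \<partial>normal_poisson \<mu>)"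
proof -
  let ?s = "\<lambda>y :: (real ^ 'd) \<times> (nat ^ 'p). (fst y + fst z, snd y)"
  let ?t = "tilt \<mu> z"
  have P: "distr P sample_space ?s = density (normal_poisson \<mu>) (\<lambda>y. ennreal (?t y))"
    unfolding P_def by (rule normal_poisson_tilt[OF assms(1)])
  have [measurable]: "?s \<in> P \<rightarrow>\<^sub>M sample_space" unfolding P_def by measurable
  have transfer: "integrable P (\<lambda>y. h (?s y)) \<longleftrightarrow> integrable (normal_poisson \<mu>) (\<lambda>y. ?t y * h y)"
    "(\<integral>y. h (?s y) \<partial>P) = (\<integral>y. ?t y * h y \<partial>normal_poisson \<mu>)"
    if [measurable]: "h \<in> borel_measurable sample_space" for h :: "(real ^ 'd) \<times> (nat ^ 'p) \<Rightarrow> real"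
  proof -
    have "integrable (distr P sample_space ?s) h = integrable P (\<lambda>y. h (?s y))"
      by (rule integrable_distr_eq) measurable
    then show "integrable P (\<lambda>y. h (?s y)) \<longleftrightarrow> integrable (normal_poisson \<mu>) (\<lambda>y. ?t y * h y)"
      unfolding P by (subst (asm) integrable_density) (auto simp: less_imp_le[OF tilt_pos])
    have "integral\<^sup>L (distr P sample_space ?s) h = (\<integral>y. h (?s y) \<partial>P)"
      by (rule integral_distr) measurable
    then show "(\<integral>y. h (?s y) \<partial>P) = (\<integral>y. ?t y * h y \<partial>normal_poisson \<mu>)"
      unfolding P by (subst (asm) integral_density) (auto simp: less_imp_le[OF tilt_pos])
  qed
  have t0: "?t y \<noteq> 0" for y using tilt_pos[of \<mu> z y] by simp
  have t4: "?t y * (f y / ?t y) ^ 4 = f y ^ 4 * ?t y powr (- 3)" for y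
    using t0[of y] tilt_pos[of \<mu> z y]
    by (simp add: powr_minus powr_numeral power_divide field_simps eval_nat_numeral)
  show "(\<integral>y. shifted_weight f \<mu> z y \<partial>P) = (\<integral>y. f y \<partial>normal_poisson \<mu>)"
    using transfer(2)[of "\<lambda>y. f y / ?t y"] t0 by (simp add: shifted_weight_def)
  show "integrable P (\<lambda>y. shifted_weight f \<mu> z y ^ 4) \<longleftrightarrow>
      integrable (normal_poisson \<mu>) (\<lambda>y. f y ^ 4 * ?t y powr (- 3))"
    unfolding t4[symmetric] shifted_weight_def by (rule transfer(1)) measurable
  show "(\<integral>y. shifted_weight f \<mu> z y ^ 4 \<partial>P) = (\<integral>y. f y ^ 4 * ?t y powr (- 3) \<partial>normal_poisson \<mu>)"
    unfolding t4[symmetric] shifted_weight_def by (rule transfer(2)) measurable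
qed

text \<open>
  On the ball of radius \<open>R\<close> the fourth moments of the summands are bounded by a continuous function
  of the parameter, hence by a constant.
\<close>

lemma second_stage_deviation:
  fixes f :: "(real ^ 'd) \<times> (nat ^ 'p) \<Rightarrow> real"
  assumes \<mu>: "pos_vec \<mu>" and \<delta>: "0 < \<delta>"
    and f [measurable]: "f \<in> borel_measurable sample_space"
    and f4: "integrable (normal_poisson \<mu>) (\<lambda>y. \<bar>f y\<bar> powr (4 + \<delta>))"
  obtains C where "0 \<le> C" and "\<And>z n e. \<lbrakk>norm z \<le> R; 1 \<le> n; 0 < e\<rbrakk> \<Longrightarrow>
    measure (PiM {1..n} (\<lambda>_. normal_poisson (tilted_rate \<mu> (snd z))))
      {y \<in> space (PiM {1..n} (\<lambda>_. normal_poisson (tilted_rate \<mu> (snd z)))).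
        e \<le> \<bar>(1 / real n) * (\<Sum>j=1..n. shifted_weight f \<mu> z (y j)) - (\<integral>y. f y \<partial>normal_poisson \<mu>)\<bar>}
      \<le> C / e ^ 4 * (1 / (real n)\<^sup>2)"
proof -
  define q where "q = 3 * (1 + 4 / \<delta>)"
  define L where "L z = exp (cumulant \<mu> (- q *\<^sub>R z) + q * cumulant \<mu> z)" for z :: "(real ^ 'd) \<times> (real ^ 'p)"
  have "continuous_on (cball 0 R) L"
    unfolding L_def
    by (intro continuous_intros continuous_on_compose2[OF continuous_on_cumulant]) auto
  then have "bounded (L ` cball 0 R)"
    by (intro compact_imp_bounded compact_continuous_image) auto
  then obtain b where b: "\<And>z. z \<in> cball 0 R \<Longrightarrow> \<bar>L z\<bar> \<le> b"
    unfolding bounded_iff real_norm_def by blast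
  define C where "C = 48 * ((\<integral>y. \<bar>f y\<bar> powr (4 + \<delta>) \<partial>normal_poisson \<mu>) + \<bar>b\<bar>)"
  show ?thesis
  proof (rule that)
    show "0 \<le> C" by (simp add: C_def)
    fix z :: "(real ^ 'd) \<times> (real ^ 'p)" and n :: nat and e :: real
    assume z: "norm z \<le> R" and n: "1 \<le> n" and e: "0 < e"
    let ?P = "normal_poisson (tilted_rate \<mu> (snd z)) :: ((real ^ 'd) \<times> (nat ^ 'p)) measure"
    note m4 = integral_power4_tilt[OF \<mu> \<delta> f f4, of z 3]
    note sw = moments_shifted_weight[OF \<mu> f, of z]
    have "measure (PiM {1..n} (\<lambda>_. ?P)) {y \<in> space (PiM {1..n} (\<lambda>_. ?P)).
        e \<le> \<bar>(1 / real n) * (\<Sum>j=1..n. shifted_weight f \<mu> z (y j)) - integral\<^sup>L ?P (shifted_weight f \<mu> z)\<bar>} \<le>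
      48 * (\<integral>y. shifted_weight f \<mu> z y ^ 4 \<partial>?P) / e ^ 4 * (1 / (real n)\<^sup>2)"
    proof (rule PiM_average_deviation[OF prob_space_normal_poisson _ _ n e])
      show "shifted_weight f \<mu> z \<in> borel_measurable ?P" by measurable
      show "integrable ?P (\<lambda>y. shifted_weight f \<mu> z y ^ 4)" using m4(1) by (simp only: sw(2))
    qed
    also have "\<dots> \<le> C / e ^ 4 * (1 / (real n)\<^sup>2)"
    proof -
      have "(\<integral>y. shifted_weight f \<mu> z y ^ 4 \<partial>?P) \<le> (\<integral>y. \<bar>f y\<bar> powr (4 + \<delta>) \<partial>normal_poisson \<mu>) + L z"
        using m4(2) by (simp only: sw(3) L_def q_def)
      also have "\<dots> \<le> (\<integral>y. \<bar>f y\<bar> powr (4 + \<delta>) \<partial>normal_poisson \<mu>) + \<bar>b\<bar>"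
        using b[of z] z by fastforce
      finally show ?thesis
        using e by (intro mult_right_mono divide_right_mono) (auto simp: C_def)
    qed
    finally show "measure (PiM {1..n} (\<lambda>_. ?P)) {y \<in> space (PiM {1..n} (\<lambda>_. ?P)).
        e \<le> \<bar>(1 / real n) * (\<Sum>j=1..n. shifted_weight f \<mu> z (y j)) - (\<integral>y. f y \<partial>normal_poisson \<mu>)\<bar>} \<le>
      C / e ^ 4 * (1 / (real n)\<^sup>2)"
      by (simp only: sw(1))
  qed
qed

section \<open>Coercivity\<close>

text \<open>
  For \<open>x < 0\<close> the term \<open>- n x\<close> alone suffices, as \<open>n \<ge> 1\<close>. For \<open>x \<ge> 0\<close> the convex function
  \<open>a e\<^sup>x\<close> lies above its tangent of slope \<open>n + 1\<close>.
\<close>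

lemma poisson_exponent_coercive:
  fixes a x :: real and n :: nat
  assumes "0 < a" "1 \<le> n"
  shows "\<bar>x\<bar> - (a + (real n + 1) * \<bar>ln ((real n + 1) / a)\<bar>) \<le> a * (exp x - 1) - real n * x"
proof (cases "0 \<le> x")
  case True
  define u where "u = ln ((real n + 1) / a)"
  have "(real n + 1) * (1 + (x - u)) \<le> (real n + 1) * exp (x - u)"
    by (intro mult_left_mono exp_ge_add_one_self) auto
  also have "\<dots> = a * exp x"
  proof -
    have "exp u = (real n + 1) / a" unfolding u_def using assms(1) by (intro exp_ln) auto
    then show ?thesis using assms(1) by (simp add: exp_diff)
  qed
  finally have "(real n + 1) * (1 + (x - u)) \<le> a * exp x" .
  moreover have "(real n + 1) * u \<le> (real n + 1) * \<bar>u\<bar>" by (intro mult_left_mono) auto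
  ultimately show ?thesis using True unfolding u_def[symmetric] by (simp add: algebra_simps)
next
  case False
  have "0 \<le> a * exp x" using assms(1) by simp
  moreover have "- x \<le> - (real n * x)" using False assms(2) by (simp add: mult_le_cancel_right1)
  moreover have "0 \<le> (real n + 1) * \<bar>ln ((real n + 1) / a)\<bar>" by simp
  moreover have "a * (exp x - 1) = a * exp x - a" by (simp add: algebra_simps)
  ultimately show ?thesis using False by linarith
qed

text \<open>
  Where all counts are positive, a factor \<open>e\<^sup>\<lambda> \<lambda>\<^sup>-\<^sup>n\<close> of the inverse likelihood ratio is large for \<open>\<lambda>\<close>
  near \<open>0\<close> and near \<open>\<infinity>\<close>; a zero count would give no control of \<open>\<lambda>\<close> near \<open>0\<close>. The
  Gaussian factor is controlled on bounded sets of \<open>g\<close>.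
\<close>

lemma inverse_tilt_coercive:
  fixes \<mu> :: "real ^ 'p" and n0 :: "nat ^ 'p"
  assumes \<mu>: "pos_vec \<mu>" and n0: "\<forall>i. n0 $ i \<noteq> 0"
  obtains C where "0 \<le> C"
    "\<And>(z :: (real ^ 'd) \<times> (real ^ 'p)) g. norm g \<le> R \<Longrightarrow> norm z - C \<le> 1 / tilt \<mu> z (g, n0)"
proof -
  define c where "c i = \<mu> $ i + (real (n0 $ i) + 1) * \<bar>ln ((real (n0 $ i) + 1) / \<mu> $ i)\<bar>" for i
  define C where "C = (\<bar>R\<bar> + 1)\<^sup>2 / 2 + \<bar>\<Sum>i\<in>UNIV. c i\<bar>"
  show ?thesis
  proof (rule that)
    show "0 \<le> C" by (simp add: C_def)
    fix z :: "(real ^ 'd) \<times> (real ^ 'p)" and g :: "real ^ 'd" assume g: "norm g \<le> R"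
    define \<theta> where "\<theta> = fst z"
    define \<eta> where "\<eta> = snd z"
    have "\<theta> \<bullet> g \<le> norm \<theta> * \<bar>R\<bar>"
      using g by (intro order_trans[OF norm_cauchy_schwarz] mult_left_mono) auto
    moreover have "norm \<theta> * (\<bar>R\<bar> + 1) \<le> (norm \<theta>)\<^sup>2 / 2 + (\<bar>R\<bar> + 1)\<^sup>2 / 2"
      using sum_squares_bound[of "norm \<theta>" "\<bar>R\<bar> + 1"] by simp
    ultimately have 1: "norm \<theta> - (\<bar>R\<bar> + 1)\<^sup>2 / 2 \<le> (norm \<theta>)\<^sup>2 / 2 - \<theta> \<bullet> g"
      by (simp add: algebra_simps)
    have "(\<Sum>i\<in>UNIV. \<bar>\<eta> $ i\<bar> - c i) \<le> (\<Sum>i\<in>UNIV. \<mu> $ i * (exp (\<eta> $ i) - 1) - real (n0 $ i) * \<eta> $ i)"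
      unfolding c_def using \<mu> n0
      by (intro sum_mono poisson_exponent_coercive) (auto simp: pos_vec_def Suc_le_eq)
    then have 2: "norm \<eta> - (\<Sum>i\<in>UNIV. c i) \<le>
        (\<Sum>i\<in>UNIV. \<mu> $ i * (exp (\<eta> $ i) - 1)) - (\<Sum>i\<in>UNIV. real (n0 $ i) * \<eta> $ i)"
      using norm_le_l1_cart[of \<eta>] by (simp add: sum_subtractf)
    have "norm z \<le> norm \<theta> + norm \<eta>"
      unfolding \<theta>_def \<eta>_def using norm_Pair_le[of "fst z" "snd z"] by simp
    then have "norm z - C \<le> cumulant \<mu> z - pairing z (g, n0)"
      using 1 2 by (simp add: C_def cumulant_def pairing_def \<theta>_def[symmetric] \<eta>_def[symmetric])
    also have "\<dots> \<le> exp (cumulant \<mu> z - pairing z (g, n0))"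
      using exp_ge_add_one_self[of "cumulant \<mu> z - pairing z (g, n0)"] by linarith
    also have "\<dots> = 1 / tilt \<mu> z (g, n0)" by (simp add: tilt_def exp_diff)
    finally show "norm z - C \<le> 1 / tilt \<mu> z (g, n0)" .
  qed
qed

section \<open>Boundedness of the minimizers\<close>

definition tilt_param :: "real ^ 'p \<Rightarrow> real ^ 'e ^ 'd \<Rightarrow> real ^ 'q ^ 'p \<Rightarrow>
    (real ^ 'e) \<times> (real ^ 'q) \<Rightarrow> (real ^ 'd) \<times> (real ^ 'p)" where
  "tilt_param \<mu> A B x = nat_param \<mu> (A *v fst x) (B *v snd x)"

lemma borel_measurable_tilt_param [measurable]:
  fixes A :: "real ^ 'e ^ 'd" and B :: "real ^ 'q ^ 'p"
  shows "tilt_param \<mu> A B \<in> borel_measurable borel"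
proof -
  have A: "(\<lambda>x :: (real ^ 'e) \<times> (real ^ 'q). A *v fst x) \<in> borel_measurable borel"
    by (intro borel_measurable_continuous_onI
        continuous_on_compose2[OF matrix_vector_mult_linear_continuous_on _ subset_UNIV] continuous_intros)
  have "continuous_on UNIV (\<lambda>x :: (real ^ 'e) \<times> (real ^ 'q). B *v snd x)"
    by (intro continuous_on_compose2[OF matrix_vector_mult_linear_continuous_on _ subset_UNIV] continuous_intros)
  then have "(\<lambda>x :: (real ^ 'e) \<times> (real ^ 'q). (B *v snd x) $ i) \<in> borel_measurable borel" for i
    by (intro borel_measurable_continuous_onI continuous_intros)
  then have "(\<lambda>x :: (real ^ 'e) \<times> (real ^ 'q). (\<chi> i. ln ((B *v snd x) $ i / \<mu> $ i)) \<bullet> b) \<in> borel_measurable borel"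
    if "b \<in> Basis" for b
    using that by (auto simp: Basis_vec_def inner_axis)
  then have "(\<lambda>x :: (real ^ 'e) \<times> (real ^ 'q). (\<chi> i. ln ((B *v snd x) $ i / \<mu> $ i))) \<in> borel_measurable borel"
    by (subst borel_measurable_euclidean_space) auto
  with A show ?thesis
    unfolding tilt_param_def nat_param_def by (rule borel_measurable_Pair)
qed

lemma v_fun_tilt_param:
  assumes "pos_vec \<mu>" "pos_vec (B *v snd x)"
  shows "v_fun f \<mu> A B s m x = (\<Sum>j=1..m. (f (s j))\<^sup>2 / tilt \<mu> (tilt_param \<mu> A B x) (s j)) / real m"
  using F_fun_nat_param[OF assms, of f "fst (s j)" "A *v fst x" "snd (s j)" for j]
  by (simp add: v_fun_def case_prod_beta tilt_param_def)

text \<open>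
  These sets increase with \<open>k\<close> to the set where \<open>snd y = n0\<close> and \<open>f y \<noteq> 0\<close>.
\<close>

lemma bounded_window_positive_measure:
  fixes f :: "(real ^ 'd) \<times> (nat ^ 'p) \<Rightarrow> real"
  assumes [measurable]: "f \<in> borel_measurable sample_space"
    and pos: "0 < measure (normal_poisson \<mu>) {y. snd y = n0 \<and> f y \<noteq> 0}"
  obtains k :: nat where "0 < measure (normal_poisson \<mu>)
    {y. snd y = n0 \<and> norm (fst y) \<le> real k \<and> 1 / real (Suc k) \<le> (f y)\<^sup>2}"
proof -
  define E where "E k = {y. snd y = n0 \<and> norm (fst y) \<le> real k \<and> 1 / real (Suc k) \<le> (f y)\<^sup>2}" for k
  interpret prob_space "normal_poisson \<mu> :: ((real ^ 'd) \<times> (nat ^ 'p)) measure"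
    by (rule prob_space_normal_poisson)
  have E: "E k \<in> sets (normal_poisson \<mu>)" for k
  proof -
    have "{y \<in> space sample_space. snd y = n0 \<and> norm (fst y) \<le> real k \<and> 1 / real (Suc k) \<le> (f y)\<^sup>2}
        \<in> sets (sample_space :: ((real ^ 'd) \<times> (nat ^ 'p)) measure)"
      by measurable
    then show ?thesis by (simp add: E_def space_pair_measure)
  qed
  have "{y. snd y = n0 \<and> f y \<noteq> 0} \<subseteq> (\<Union>k. E k)"
  proof
    fix y assume y: "y \<in> {y. snd y = n0 \<and> f y \<noteq> 0}"
    then have "0 < (f y)\<^sup>2" by simp
    then obtain i where i: "inverse (real (Suc i)) < (f y)\<^sup>2" using reals_Archimedean by blast
    obtain j where j: "norm (fst y) \<le> real j" using real_arch_simple by blast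
    have "1 / real (Suc (max i j)) \<le> 1 / real (Suc i)" by (intro divide_left_mono) auto
    also have "\<dots> \<le> (f y)\<^sup>2" using i by (simp add: inverse_eq_divide)
    finally have "y \<in> E (max i j)" using y j by (auto simp: E_def)
    then show "y \<in> (\<Union>k. E k)" by blast
  qed
  have "\<exists>k. 0 < measure (normal_poisson \<mu>) (E k)"
  proof (rule ccontr)
    assume "\<not> ?thesis"
    then have "E k \<in> null_sets (normal_poisson \<mu>)" for k
      using E[of k] measure_nonneg[of "normal_poisson \<mu>" "E k"]
      by (intro null_setsI) (auto simp: emeasure_eq_measure not_less order_antisym)
    then have "(\<Union>k. E k) \<in> null_sets (normal_poisson \<mu>)" by (intro null_sets_UN) auto
    then have "measure (normal_poisson \<mu>) (\<Union>k. E k) = 0" by (rule measure_eq_0_null_sets)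
    moreover have "measure (normal_poisson \<mu>) {y. snd y = n0 \<and> f y \<noteq> 0} \<le> measure (normal_poisson \<mu>) (\<Union>k. E k)"
      by (rule finite_measure_mono) (use \<open>_ \<subseteq> _\<close> E in auto)
    ultimately show False using pos by simp
  qed
  then show ?thesis using that unfolding E_def by blast
qed

text \<open>
  Let \<open>v\<^sub>m\<close> be the function minimized and \<open>E\<close> a set of points with \<open>snd y = n0\<close>, bounded first
  component and \<open>|f|\<close> bounded away from zero. On \<open>E\<close> the summands of \<open>v\<^sub>m\<close> grow at least linearly in
  the parameter, and the sample visits \<open>E\<close> with a positive frequency. Therefore
  \<open>r (\<parallel>z\<parallel> - C) \<le> v\<^sub>m(z)\<close> with \<open>r > 0\<close>, whereas the minimal value is at most the value at \<open>x0\<close>, an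
  average of square integrable terms, which stays bounded.
\<close>

lemma minimizer_eventually_bounded:
  fixes f :: "(real ^ 'd) \<times> (nat ^ 'p) \<Rightarrow> real" and A :: "real ^ 'e ^ 'd" and B :: "real ^ 'q ^ 'p"
  assumes M: "prob_space M" and \<mu>: "pos_vec \<mu>" and \<delta>: "0 < \<delta>"
    and f [measurable]: "f \<in> borel_measurable sample_space"
    and f4: "integrable (normal_poisson \<mu>) (\<lambda>y. \<bar>f y\<bar> powr (4 + \<delta>))"
    and B: "\<forall>l. pos_vec l \<longrightarrow> pos_vec (B *v l)" and x0: "admissible x0"
    and n0: "\<forall>i. n0 $ i \<noteq> 0" and pos: "0 < measure (normal_poisson \<mu>) {y. snd y = n0 \<and> f y \<noteq> 0}"
    and X: "\<And>j. 1 \<le> j \<Longrightarrow> X j \<in> M \<rightarrow>\<^sub>M sample_space"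
    and law: "\<And>j. 1 \<le> j \<Longrightarrow> distr M sample_space (X j) = normal_poisson \<mu>"
    and ind: "prob_space.indep_vars M (\<lambda>_. sample_space) X {1..}"
  obtains R where "AE \<omega> in M. \<forall>\<^sub>F m in sequentially.
    norm (tilt_param \<mu> A B (minimizer f \<mu> A B x0 (\<lambda>j. X j \<omega>) m)) \<le> R"
proof -
  interpret M: prob_space M by fact
  let ?P = "normal_poisson \<mu> :: ((real ^ 'd) \<times> (nat ^ 'p)) measure"
  interpret P: prob_space ?P by (rule prob_space_normal_poisson)
  obtain k where k: "0 < measure ?P {y. snd y = n0 \<and> norm (fst y) \<le> real k \<and> 1 / real (Suc k) \<le> (f y)\<^sup>2}"
    using bounded_window_positive_measure[OF f pos] by blast
  define E where "E = {y. snd y = n0 \<and> norm (fst y) \<le> real k \<and> 1 / real (Suc k) \<le> (f y)\<^sup>2}"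
  define p where "p = measure ?P E"
  have p: "0 < p" using k by (simp add: p_def E_def)
  have E [measurable]: "E \<in> sets sample_space"
  proof -
    have "{y \<in> space sample_space. snd y = n0 \<and> norm (fst y) \<le> real k \<and> 1 / real (Suc k) \<le> (f y)\<^sup>2}
        \<in> sets (sample_space :: ((real ^ 'd) \<times> (nat ^ 'p)) measure)"
      by measurable
    then show ?thesis by (simp add: E_def space_pair_measure)
  qed
  obtain C where C: "0 \<le> C" "\<And>(z :: (real ^ 'd) \<times> (real ^ 'p)) g. norm g \<le> real k \<Longrightarrow> norm z - C \<le> 1 / tilt \<mu> z (g, n0)"
    using inverse_tilt_coercive[OF \<mu> n0] by blast
  define z0 where "z0 = tilt_param \<mu> A B x0"
  define U where "U y = (f y)\<^sup>2 / tilt \<mu> z0 y" for y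
  define a where "a = integral\<^sup>L ?P U"

  have averages: "AE \<omega> in M. \<forall>\<^sub>F m in sequentially.
      (integral\<^sup>L ?P h - e) / 2 \<le> (\<Sum>j=1..m. h (X j \<omega>)) / real m \<and>
      (\<Sum>j=1..m. h (X j \<omega>)) / real m \<le> 2 * (integral\<^sup>L ?P h + e)"
    if h [measurable]: "h \<in> borel_measurable sample_space" and h0: "\<And>y. 0 \<le> h y"
      and h2: "integrable ?P (\<lambda>y. (h y)\<^sup>2)" and e: "0 < e" for h e
  proof (rule M.AE_eventually_averages_bounded[where C = "\<integral>y. (h y)\<^sup>2 \<partial>?P"])
    show "M.indep_vars (\<lambda>_. borel) (\<lambda>j \<omega>. h (X j \<omega>)) {1..}"
      by (rule M.indep_vars_compose2[OF ind]) measurable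
    fix j :: nat assume j: "1 \<le> j"
    note [measurable] = X[OF j]
    have "integrable (distr M sample_space (X j)) (\<lambda>y. (h y)\<^sup>2) = integrable M (\<lambda>\<omega>. (h (X j \<omega>))\<^sup>2)"
      by (rule integrable_distr_eq) measurable
    then show "integrable M (\<lambda>\<omega>. (h (X j \<omega>))\<^sup>2)" using h2 by (simp only: law[OF j])
    have "integral\<^sup>L (distr M sample_space (X j)) h = M.expectation (\<lambda>\<omega>. h (X j \<omega>))"
      by (rule integral_distr) measurable
    then show "M.expectation (\<lambda>\<omega>. h (X j \<omega>)) = integral\<^sup>L ?P h" by (simp only: law[OF j])
    have "integral\<^sup>L (distr M sample_space (X j)) (\<lambda>y. (h y)\<^sup>2) = M.expectation (\<lambda>\<omega>. (h (X j \<omega>))\<^sup>2)"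
      by (rule integral_distr) measurable
    then show "M.expectation (\<lambda>\<omega>. (h (X j \<omega>))\<^sup>2) \<le> (\<integral>y. (h y)\<^sup>2 \<partial>?P)" by (simp only: law[OF j])
  qed (use h0 e in auto)
  have "AE \<omega> in M. \<forall>\<^sub>F m in sequentially.
      (integral\<^sup>L ?P (indicator E) - p / 2) / 2 \<le> (\<Sum>j=1..m. indicator E (X j \<omega>)) / real m \<and>
      (\<Sum>j=1..m. indicator E (X j \<omega>)) / real m \<le> 2 * (integral\<^sup>L ?P (indicator E) + p / 2)"
  proof (rule averages)
    show "integrable ?P (\<lambda>y. (indicator E y :: real)\<^sup>2)"
      by (rule P.integrable_const_bound[where B = 1]) (auto simp: indicator_def)
  qed (use p in auto)
  moreover have "(integral\<^sup>L ?P (indicator E) - p / 2) / 2 = p / 4" by (simp add: p_def)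
  ultimately have freq: "AE \<omega> in M. \<forall>\<^sub>F m in sequentially. p / 4 \<le> (\<Sum>j=1..m. indicator E (X j \<omega>)) / real m"
    by (simp only:) (auto elim!: eventually_mono)
  have "AE \<omega> in M. \<forall>\<^sub>F m in sequentially.
      (integral\<^sup>L ?P U - 1) / 2 \<le> (\<Sum>j=1..m. U (X j \<omega>)) / real m \<and>
      (\<Sum>j=1..m. U (X j \<omega>)) / real m \<le> 2 * (integral\<^sup>L ?P U + 1)"
  proof (rule averages)
    show "U \<in> borel_measurable sample_space" unfolding U_def by measurable
    show "0 \<le> U y" for y unfolding U_def using tilt_pos[of \<mu> z0 y] by simp
    have "(U y)\<^sup>2 = f y ^ 4 * tilt \<mu> z0 y powr (- 2)" for y
      using tilt_pos[of \<mu> z0 y]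
      by (simp add: U_def powr_minus powr_numeral power_divide divide_inverse power_mult_distrib power_inverse flip: power_mult)
    then show "integrable ?P (\<lambda>y. (U y)\<^sup>2)"
      using integral_power4_tilt(1)[OF \<mu> \<delta> f f4, of z0 2] by simp
  qed simp
  then have cost: "AE \<omega> in M. \<forall>\<^sub>F m in sequentially. (\<Sum>j=1..m. U (X j \<omega>)) / real m \<le> 2 * (a + 1)"
    unfolding a_def by (auto elim!: eventually_mono)

  define r where "r = p / 4 * (1 / real (Suc k))"
  have r: "0 < r" using p by (simp add: r_def)
  define R where "R = C + \<bar>2 * (a + 1)\<bar> / r"
  have "AE \<omega> in M. \<forall>\<^sub>F m in sequentially. norm (tilt_param \<mu> A B (minimizer f \<mu> A B x0 (\<lambda>j. X j \<omega>) m)) \<le> R"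
    using freq cost
  proof eventually_elim
    case (elim \<omega>)
    then show ?case
    proof eventually_elim
      case (elim m)
      let ?s = "\<lambda>j. X j \<omega>"
      let ?x = "minimizer f \<mu> A B x0 ?s m"
      define z where "z = tilt_param \<mu> A B ?x"
      \<comment> \<open>both sides of the comparison in the parameter of the exponential family\<close>
      have v: "v_fun f \<mu> A B ?s m x = (\<Sum>j=1..m. (f (?s j))\<^sup>2 / tilt \<mu> (tilt_param \<mu> A B x) (?s j)) / real m"
        if "admissible x" for x
        using B that by (intro v_fun_tilt_param[OF \<mu>]) (simp add: admissible_def)
      have "norm z - C \<le> \<bar>2 * (a + 1)\<bar> / r"
      proof (cases "norm z \<le> C")
        case True
        moreover have "0 \<le> \<bar>2 * (a + 1)\<bar> / r" using r by simp
        ultimately show ?thesis by linarith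
      next
        case False
        have "r * (norm z - C) \<le> (\<Sum>j=1..m. indicator E (?s j)) / real m * (1 / real (Suc k)) * (norm z - C)"
          unfolding r_def using elim(1) False by (intro mult_right_mono) auto
        also have "\<dots> = (\<Sum>j=1..m. indicator E (?s j) * (1 / real (Suc k) * (norm z - C))) / real m"
          unfolding sum_distrib_right[symmetric] by simp
        also have "\<dots> \<le> (\<Sum>j=1..m. (f (?s j))\<^sup>2 / tilt \<mu> z (?s j)) / real m"
        proof (intro divide_right_mono sum_mono)
          fix j
          show "indicator E (?s j) * (1 / real (Suc k) * (norm z - C)) \<le> (f (?s j))\<^sup>2 / tilt \<mu> z (?s j)"
          proof (cases "?s j \<in> E")
            case True
            then have s: "?s j = (fst (?s j), n0)" "norm (fst (?s j)) \<le> real k" "1 / real (Suc k) \<le> (f (?s j))\<^sup>2"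
              by (auto simp: E_def prod_eq_iff)
            have "norm z - C \<le> 1 / tilt \<mu> z (?s j)"
              by (subst s(1)) (rule C(2)[OF s(2)])
            then have "1 / real (Suc k) * (norm z - C) \<le> (f (?s j))\<^sup>2 * (1 / tilt \<mu> z (?s j))"
              using s(3) False by (intro mult_mono) auto
            then show ?thesis using True by simp
          qed (use tilt_pos[of \<mu> z "?s j"] in auto)
        qed simp
        also have "\<dots> = v_fun f \<mu> A B ?s m ?x"
          unfolding z_def by (rule v[symmetric]) (rule minimizer_admissible(1)[OF x0])
        also have "\<dots> \<le> v_fun f \<mu> A B ?s m x0"
          by (rule minimizer_admissible(2)[OF x0])
        also have "\<dots> = (\<Sum>j=1..m. U (?s j)) / real m"
          unfolding U_def z0_def by (rule v[OF x0])
        also have "\<dots> \<le> \<bar>2 * (a + 1)\<bar>" using elim(2) by linarith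
        finally show ?thesis using r by (simp add: field_simps)
      qed
      then show ?case by (simp add: R_def z_def)
    qed
  qed
  then show ?thesis by (rule that)
qed

section \<open>Strong law for the importance sampling estimator\<close>

lemma normal_poisson_tilted_rate:
  assumes "pos_vec \<mu>"
  shows "(normal_poisson (tilted_rate \<mu> \<eta>) :: ((real ^ 'd) \<times> (nat ^ 'p)) measure) =
    density (normal_poisson \<mu>) (\<lambda>y. ennreal (tilt \<mu> (0, \<eta>) y))"
proof -
  have "distr (normal_poisson (tilted_rate \<mu> \<eta>)) sample_space (\<lambda>y. y) =
      (normal_poisson (tilted_rate \<mu> \<eta>) :: ((real ^ 'd) \<times> (nat ^ 'p)) measure)"
    by (rule distr_id2) simp
  then show ?thesis
    using normal_poisson_tilt[OF assms, of "(0 :: real ^ 'd, \<eta>)"] by simp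
qed

text \<open>
  The tail bound for fixed parameters is averaged over the first stage, restricted to the event that
  the parameter lies in the ball of radius \<open>R\<close>. The parameter is measurable with respect to the
  first stage, and the conditional law has the density \<open>W\<close>, a product of tilts without shift, as
  the shift is part of the summands.
\<close>

lemma second_stage_tail_bound:
  fixes f :: "(real ^ 'd) \<times> (nat ^ 'p) \<Rightarrow> real" and A :: "real ^ 'e ^ 'd" and B :: "real ^ 'q ^ 'p"
  assumes M: "prob_space M" and \<mu>: "pos_vec \<mu>" and \<delta>: "0 < \<delta>"
    and f [measurable]: "f \<in> borel_measurable sample_space"
    and f4: "integrable (normal_poisson \<mu>) (\<lambda>y. \<bar>f y\<bar> powr (4 + \<delta>))"
    and B: "\<forall>l. pos_vec l \<longrightarrow> pos_vec (B *v l)" and x0: "admissible x0"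
    and X: "\<And>j. 1 \<le> j \<Longrightarrow> X j \<in> M \<rightarrow>\<^sub>M sample_space"
  obtains C where "\<And>n k e T. \<lbrakk>1 \<le> n; 0 < e;
      has_cond_law M (first_stage_algebra M X) (PiM {1..n} (\<lambda>_. sample_space))
        (\<lambda>\<omega>. \<lambda>j\<in>{1..n}. T j \<omega>)
        (\<lambda>\<omega>. PiM {1..n} (\<lambda>_. normal_poisson (B *v ell_min f \<mu> A B x0 (\<lambda>j. X j \<omega>) k)))\<rbrakk> \<Longrightarrow>
      {\<omega> \<in> space M. norm (tilt_param \<mu> A B (minimizer f \<mu> A B x0 (\<lambda>j. X j \<omega>) k)) \<le> R \<and>
        e \<le> \<bar>M_est f \<mu> A B x0 (\<lambda>j. X j \<omega>) (\<lambda>j. T j \<omega>) n k - (\<integral>y. f y \<partial>normal_poisson \<mu>)\<bar>} \<in> sets M \<and>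
      measure M {\<omega> \<in> space M. norm (tilt_param \<mu> A B (minimizer f \<mu> A B x0 (\<lambda>j. X j \<omega>) k)) \<le> R \<and>
        e \<le> \<bar>M_est f \<mu> A B x0 (\<lambda>j. X j \<omega>) (\<lambda>j. T j \<omega>) n k - (\<integral>y. f y \<partial>normal_poisson \<mu>)\<bar>}
        \<le> C / e ^ 4 * (1 / (real n)\<^sup>2)"
proof -
  let ?P = "normal_poisson \<mu> :: ((real ^ 'd) \<times> (nat ^ 'p)) measure"
  let ?H = "first_stage_algebra M X"
  define c where "c = (\<integral>y. f y \<partial>?P)"
  obtain C where C0: "0 \<le> C" and C: "\<And>z n e. \<lbrakk>norm z \<le> R; 1 \<le> n; 0 < e\<rbrakk> \<Longrightarrow>
    measure (PiM {1..n} (\<lambda>_. normal_poisson (tilted_rate \<mu> (snd z))))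
      {y \<in> space (PiM {1..n} (\<lambda>_. normal_poisson (tilted_rate \<mu> (snd z)))).
        e \<le> \<bar>(1 / real n) * (\<Sum>j=1..n. shifted_weight f \<mu> z (y j)) - c\<bar>} \<le> C / e ^ 4 * (1 / (real n)\<^sup>2)"
    unfolding c_def using second_stage_deviation[OF \<mu> \<delta> f f4] by blast
  show ?thesis
  proof (rule that)
    fix n k :: nat and e :: real and T :: "nat \<Rightarrow> 'a \<Rightarrow> (real ^ 'd) \<times> (nat ^ 'p)"
    assume n: "1 \<le> n" and e: "0 < e"
      and cond: "has_cond_law M ?H (PiM {1..n} (\<lambda>_. sample_space)) (\<lambda>\<omega>. \<lambda>j\<in>{1..n}. T j \<omega>)
        (\<lambda>\<omega>. PiM {1..n} (\<lambda>_. normal_poisson (B *v ell_min f \<mu> A B x0 (\<lambda>j. X j \<omega>) k)))"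
    let ?Q = "PiM {1..n} (\<lambda>_. ?P)"
    let ?x = "\<lambda>\<omega>. minimizer f \<mu> A B x0 (\<lambda>j. X j \<omega>) k"
    let ?Z = "\<lambda>\<omega>. tilt_param \<mu> A B (?x \<omega>)"
    let ?Y = "\<lambda>\<omega>. \<lambda>j\<in>{1..n}. T j \<omega>"
    let ?K = "\<lambda>\<omega>. PiM {1..n} (\<lambda>_. normal_poisson (B *v ell_min f \<mu> A B x0 (\<lambda>j. X j \<omega>) k))
      :: (nat \<Rightarrow> (real ^ 'd) \<times> (nat ^ 'p)) measure"
    define W where "W z y = (\<Prod>j\<in>{1..n}. ennreal (tilt \<mu> (0, snd z) (y j)))"
      for z :: "(real ^ 'd) \<times> (real ^ 'p)" and y :: "nat \<Rightarrow> (real ^ 'd) \<times> (nat ^ 'p)"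
    define D where "D = {x \<in> space (borel \<Otimes>\<^sub>M ?Q). norm (fst x) \<le> R \<and>
      e \<le> \<bar>(1 / real n) * (\<Sum>j=1..n. shifted_weight f \<mu> (fst x) (snd x j)) - c\<bar>}"
    have rate: "pos_vec (B *v snd (?x \<omega>))" for \<omega>
      using minimizer_admissible(1)[OF x0, unfolded admissible_def] B by blast
    have K: "?K \<omega> = PiM {1..n} (\<lambda>_. normal_poisson (tilted_rate \<mu> (snd (?Z \<omega>))))" for \<omega>
      unfolding tilt_param_def tilted_rate_nat_param[OF \<mu> rate] ell_min_def ..
    have M_est: "M_est f \<mu> A B x0 (\<lambda>j. X j \<omega>) (\<lambda>j. T j \<omega>) n k =
        (1 / real n) * (\<Sum>j=1..n. shifted_weight f \<mu> (?Z \<omega>) (?Y \<omega> j))" for \<omega>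
      unfolding M_est_def theta_min_def ell_min_def importance_estimator_nat_param[OF \<mu> rate] tilt_param_def
      by simp
    have comp [measurable]: "(\<lambda>x. snd x j) \<in> borel \<Otimes>\<^sub>M ?Q \<rightarrow>\<^sub>M sample_space" if "j \<in> {1..n}" for j
    proof -
      have "(\<lambda>y. y j) \<in> ?Q \<rightarrow>\<^sub>M ?P" by (rule measurable_component_singleton[OF that])
      then have "(\<lambda>y. y j) \<in> ?Q \<rightarrow>\<^sub>M sample_space" by (simp cong: measurable_cong_sets)
      then show ?thesis by measurable
    qed
    have D: "D \<in> sets (borel \<Otimes>\<^sub>M ?Q)"
    proof -
      have [measurable]: "(\<lambda>x. shifted_weight f \<mu> (fst x) (snd x j)) \<in> borel_measurable (borel \<Otimes>\<^sub>M ?Q)"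
        if j: "j \<in> {1..n}" for j
      proof -
        note [measurable] = comp[OF j]
        have "(\<lambda>x. (fst x, snd x j)) \<in> borel \<Otimes>\<^sub>M ?Q \<rightarrow>\<^sub>M borel \<Otimes>\<^sub>M sample_space" by measurable
        from measurable_compose[OF this borel_measurable_shifted_weight[OF f]] show ?thesis by simp
      qed
      show ?thesis unfolding D_def by measurable
    qed
    have W: "case_prod W \<in> borel_measurable (borel \<Otimes>\<^sub>M ?Q)"
    proof -
      have [measurable]: "(\<lambda>x. tilt \<mu> (0, snd (fst x)) (snd x j)) \<in> borel_measurable
          ((borel :: ((real ^ 'd) \<times> (real ^ 'p)) measure) \<Otimes>\<^sub>M ?Q)"
        if j: "j \<in> {1..n}" for j
      proof -
        have "(\<lambda>z :: (real ^ 'd) \<times> (real ^ 'p). (0 :: real ^ 'd, snd z)) \<in> borel_measurable borel"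
          by (intro borel_measurable_continuous_onI continuous_intros)
        from measurable_compose[OF measurable_Pair[OF measurable_compose[OF measurable_fst this] comp[OF j]]
            borel_measurable_tilt]
        show ?thesis by simp
      qed
      show ?thesis unfolding W_def case_prod_beta by measurable
    qed
    have dens: "?K \<omega> = density ?Q (W (?Z \<omega>))" for \<omega>
      unfolding K normal_poisson_tilted_rate[OF \<mu>] W_def
      by (rule PiM_density) (auto intro: prob_space_normal_poisson prob_space_tilt[OF \<mu>])
    have Z: "?Z \<in> borel_measurable ?H"
      by (rule measurable_compose[OF measurable_minimizer[OF f B X] borel_measurable_tilt_param])
    have sub: "subalgebra M ?H" by (rule subalgebra_first_stage[OF X])
    have sQ: "sets ?Q = sets (PiM {1..n} (\<lambda>_. sample_space :: ((real ^ 'd) \<times> (nat ^ 'p)) measure))"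
      by (intro sets_PiM_cong refl sets_normal_poisson)
    have sfQ: "sigma_finite_measure ?Q"
      by (intro prob_space_imp_sigma_finite prob_space_PiM prob_space_normal_poisson)
    have pK: "prob_space (?K \<omega>)" for \<omega>
      by (intro prob_space_PiM prob_space_normal_poisson)
    have bound: "measure (?K \<omega>) {y \<in> space ?Q. (?Z \<omega>, y) \<in> D} \<le> C / e ^ 4 * (1 / (real n)\<^sup>2)" for \<omega>
    proof (cases "norm (?Z \<omega>) \<le> R")
      case True
      have "{y \<in> space ?Q. (?Z \<omega>, y) \<in> D} = {y \<in> space (?K \<omega>).
          e \<le> \<bar>(1 / real n) * (\<Sum>j=1..n. shifted_weight f \<mu> (?Z \<omega>) (y j)) - c\<bar>}"
        using True by (auto simp: D_def space_pair_measure space_PiM)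
      then show ?thesis using C[OF True n e] by (simp only: K)
    next
      case False
      then have empty: "{y \<in> space ?Q. (?Z \<omega>, y) \<in> D} = {}" by (auto simp: D_def)
      show ?thesis unfolding empty measure_empty using C0 e by simp
    qed
    have event: "{\<omega> \<in> space M. (?Z \<omega>, ?Y \<omega>) \<in> D} =
        {\<omega> \<in> space M. norm (?Z \<omega>) \<le> R \<and>
          e \<le> \<bar>M_est f \<mu> A B x0 (\<lambda>j. X j \<omega>) (\<lambda>j. T j \<omega>) n k - (\<integral>y. f y \<partial>normal_poisson \<mu>)\<bar>}"
      unfolding D_def M_est c_def by (auto simp: space_pair_measure space_PiM)
    show "{\<omega> \<in> space M. norm (?Z \<omega>) \<le> R \<and>
        e \<le> \<bar>M_est f \<mu> A B x0 (\<lambda>j. X j \<omega>) (\<lambda>j. T j \<omega>) n k - (\<integral>y. f y \<partial>normal_poisson \<mu>)\<bar>} \<in> sets M \<and>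
      measure M {\<omega> \<in> space M. norm (?Z \<omega>) \<le> R \<and>
        e \<le> \<bar>M_est f \<mu> A B x0 (\<lambda>j. X j \<omega>) (\<lambda>j. T j \<omega>) n k - (\<integral>y. f y \<partial>normal_poisson \<mu>)\<bar>}
        \<le> C / e ^ 4 * (1 / (real n)\<^sup>2)"
      unfolding event[symmetric]
      using measure_le_of_cond_law[OF M sub Z cond sfQ sQ W dens pK D bound] by blast
  qed
qed

text \<open>
  The assumption on \<open>f\<close> concerns the law of \<open>G\<close> alone; by independence, and because every vector of
  counts has a positive Poisson probability, it gives mass to the slice \<open>snd y = n0\<close>.
\<close>

lemma measure_slice_pos:
  fixes f :: "(real ^ 'd) \<times> (nat ^ 'p) \<Rightarrow> real"
  assumes M: "prob_space M" and "pos_vec \<mu>" and GN: "is_normal_poisson M \<mu> G N"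
    and f [measurable]: "f \<in> borel_measurable sample_space"
    and pos: "0 < measure M {\<omega> \<in> space M. 0 < \<bar>f (G \<omega>, n0)\<bar>}"
  shows "0 < measure (normal_poisson \<mu>) {y. snd y = n0 \<and> f y \<noteq> 0}"
proof -
  interpret M: prob_space M by fact
  interpret S: prob_space "std_normal_vec :: (real ^ 'd) measure" by (rule prob_space_std_normal_vec)
  interpret P: prob_space "normal_poisson \<mu> :: ((real ^ 'd) \<times> (nat ^ 'p)) measure"
    by (rule prob_space_normal_poisson)
  define V where "V = {g. f (g, n0) \<noteq> 0}"
  have [measurable]: "(\<lambda>\<omega>. (G \<omega>, N \<omega>)) \<in> M \<rightarrow>\<^sub>M sample_space"
    and law: "distr M sample_space (\<lambda>\<omega>. (G \<omega>, N \<omega>)) = normal_poisson \<mu>"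
    using GN by (auto simp: is_normal_poisson_def)
  have V [measurable]: "V \<in> sets borel"
  proof -
    have [measurable]: "(\<lambda>g. f (g, n0)) \<in> borel_measurable borel"
      by (rule measurable_compose[OF _ f]) measurable
    have "{g \<in> space borel. f (g, n0) \<noteq> 0} \<in> sets borel" by measurable
    then show ?thesis by (simp add: V_def)
  qed
  have prod: "emeasure (normal_poisson \<mu>) (V \<times> T) = emeasure std_normal_vec V * emeasure (measure_pmf (poisson_vec \<mu>)) T" for T
    unfolding normal_poisson_def by (rule measure_pmf.emeasure_pair_measure_Times) auto
  have "{\<omega> \<in> space M. 0 < \<bar>f (G \<omega>, n0)\<bar>} = (\<lambda>\<omega>. (G \<omega>, N \<omega>)) -` (V \<times> UNIV) \<inter> space M"
    by (auto simp: V_def)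
  then have "emeasure M {\<omega> \<in> space M. 0 < \<bar>f (G \<omega>, n0)\<bar>} =
      emeasure (distr M sample_space (\<lambda>\<omega>. (G \<omega>, N \<omega>))) (V \<times> UNIV)"
    by (subst emeasure_distr) auto
  also have "\<dots> = emeasure std_normal_vec V"
    unfolding law prod using measure_pmf.emeasure_space_1[of "poisson_vec \<mu>"] by simp
  finally have eq: "emeasure M {\<omega> \<in> space M. 0 < \<bar>f (G \<omega>, n0)\<bar>} = emeasure std_normal_vec V" .
  have "0 < emeasure M {\<omega> \<in> space M. 0 < \<bar>f (G \<omega>, n0)\<bar>}"
    unfolding M.emeasure_eq_measure using pos by (simp only: ennreal_less_zero_iff)
  then have "0 < emeasure std_normal_vec V" by (simp only: eq)
  moreover have "0 < emeasure (measure_pmf (poisson_vec \<mu>)) {n0}"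
    using assms(2) by (auto simp: emeasure_pmf_single pmf_poisson_vec pos_vec_def intro!: prod_pos)
  ultimately have "0 < emeasure (normal_poisson \<mu>) (V \<times> {n0})"
    by (simp add: prod ennreal_zero_less_mult_iff)
  also have "V \<times> {n0} = {y. snd y = n0 \<and> f y \<noteq> 0}" by (auto simp: V_def)
  finally show ?thesis by (simp add: P.emeasure_eq_measure)
qed

theorem theorem3p3:
  fixes M :: "'w measure"
    and \<mu> :: "real ^ 'p"
    and f :: "(real ^ 'd) \<times> (nat ^ 'p) \<Rightarrow> real"
    and G :: "'w \<Rightarrow> real ^ 'd" and N :: "'w \<Rightarrow> nat ^ 'p"
    and Gs :: "nat \<Rightarrow> 'w \<Rightarrow> real ^ 'd" and Ns :: "nat \<Rightarrow> 'w \<Rightarrow> nat ^ 'p"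
    and Gb :: "nat \<Rightarrow> nat \<Rightarrow> nat \<Rightarrow> 'w \<Rightarrow> real ^ 'd"
    and Nb :: "nat \<Rightarrow> nat \<Rightarrow> nat \<Rightarrow> 'w \<Rightarrow> nat ^ 'p"
    and A :: "real ^ 'e ^ 'd" and B :: "real ^ 'q ^ 'p"
    and x0 :: "(real ^ 'e) \<times> (real ^ 'q)"
    and m :: "nat \<Rightarrow> nat"
  assumes "prob_space M"
    and "pos_vec \<mu>"
    and "is_normal_poisson M \<mu> G N"
    and "f \<in> borel_measurable sample_space"
    and "integrable M (\<lambda>\<omega>. f (G \<omega>, N \<omega>))"
    \<comment> \<open>the matrices \<open>A\<close> and \<open>B\<close>\<close>
    and "CARD('e) \<le> CARD('d)" and "CARD('q) \<le> CARD('p)"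
    and "rank A = CARD('e)"
    and "rank B = CARD('q)"
    and "\<forall>i k. 0 \<le> B $ i $ k"
    and "\<forall>l. pos_vec l \<longrightarrow> pos_vec (B *v l)"
    \<comment> \<open>the conventional value of the minimizer where it does not exist\<close>
    and "admissible x0"
    \<comment> \<open>first stage: i.i.d. copies of \<open>(G, N)\<close>\<close>
    and "\<forall>j\<ge>1. is_normal_poisson M \<mu> (Gs j) (Ns j)"
    and "prob_space.indep_vars M (\<lambda>_. sample_space) (\<lambda>j \<omega>. (Gs j \<omega>, Ns j \<omega>)) {1..}"
    \<comment> \<open>second stage: conditionally on the first stage, \<open>n\<close> i.i.d. pairs, the Poisson rates being \<open>B\<ell>\<^sub>m\<close>\<close>
    and "\<forall>n\<ge>1. \<forall>k\<ge>1.
      has_cond_law M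
        (first_stage_algebra M (\<lambda>j \<omega>. (Gs j \<omega>, Ns j \<omega>)))
        (PiM {1..n} (\<lambda>_. sample_space))
        (\<lambda>\<omega>. \<lambda>j\<in>{1..n}. (Gb n k j \<omega>, Nb n k j \<omega>))
        (\<lambda>\<omega>. PiM {1..n} (\<lambda>_. normal_poisson
            (B *v ell_min f \<mu> A B x0 (\<lambda>j. (Gs j \<omega>, Ns j \<omega>)) k)))"
    and "mono m" and "filterlim m at_top at_top"
    and "\<exists>n0 :: nat ^ 'p. (\<forall>i. n0 $ i \<noteq> 0) \<and>
           measure M {\<omega> \<in> space M. \<bar>f (G \<omega>, n0)\<bar> > 0} > 0"
    and "\<exists>\<gamma>>0. integrable M (\<lambda>\<omega>. \<bar>f (G \<omega>, N \<omega>)\<bar> powr (2 + \<gamma>))"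
    and "\<exists>\<delta>>0. integrable M (\<lambda>\<omega>. \<bar>f (G \<omega>, N \<omega>)\<bar> powr (4 + \<delta>))"
  shows "AE \<omega> in M.
    (\<lambda>n. M_est f \<mu> A B x0 (\<lambda>j. (Gs j \<omega>, Ns j \<omega>)) (\<lambda>j. (Gb n (m n) j \<omega>, Nb n (m n) j \<omega>)) n (m n))
      \<longlonglongrightarrow> (\<integral>\<omega>'. f (G \<omega>', N \<omega>') \<partial>M)"
proof -
  let ?X = "\<lambda>j \<omega>. (Gs j \<omega>, Ns j \<omega>)"
  let ?P = "normal_poisson \<mu> :: ((real ^ 'd) \<times> (nat ^ 'p)) measure"
  let ?z = "\<lambda>\<omega> k. tilt_param \<mu> A B (minimizer f \<mu> A B x0 (\<lambda>j. ?X j \<omega>) k)"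
  let ?M = "\<lambda>\<omega> n. M_est f \<mu> A B x0 (\<lambda>j. ?X j \<omega>) (\<lambda>j. (Gb n (m n) j \<omega>, Nb n (m n) j \<omega>)) n (m n)"
  note M = assms(1) and \<mu> = assms(2) and GN = assms(3) and f [measurable] = assms(4)
    and B = assms(11) and x0 = assms(12) and second = assms(15)
  interpret M: prob_space M by fact
  have GN_meas [measurable]: "(\<lambda>\<omega>. (G \<omega>, N \<omega>)) \<in> M \<rightarrow>\<^sub>M sample_space"
    and GN_law: "distr M sample_space (\<lambda>\<omega>. (G \<omega>, N \<omega>)) = ?P"
    using GN by (auto simp: is_normal_poisson_def)
  have X: "?X j \<in> M \<rightarrow>\<^sub>M sample_space" and X_law: "distr M sample_space (?X j) = ?P" if "1 \<le> j" for j
    using assms(13) that by (auto simp: is_normal_poisson_def)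
  obtain \<delta> where \<delta>: "0 < \<delta>" "integrable M (\<lambda>\<omega>. \<bar>f (G \<omega>, N \<omega>)\<bar> powr (4 + \<delta>))"
    using assms(20) by blast
  have "integrable (distr M sample_space (\<lambda>\<omega>. (G \<omega>, N \<omega>))) (\<lambda>y. \<bar>f y\<bar> powr (4 + \<delta>)) =
      integrable M (\<lambda>\<omega>. \<bar>f (G \<omega>, N \<omega>)\<bar> powr (4 + \<delta>))"
    by (rule integrable_distr_eq) measurable
  then have f4: "integrable ?P (\<lambda>y. \<bar>f y\<bar> powr (4 + \<delta>))" using \<delta>(2) by (simp only: GN_law)
  have "integral\<^sup>L (distr M sample_space (\<lambda>\<omega>. (G \<omega>, N \<omega>))) f = (\<integral>\<omega>. f (G \<omega>, N \<omega>) \<partial>M)"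
    by (rule integral_distr) measurable
  then have mean: "(\<integral>\<omega>. f (G \<omega>, N \<omega>) \<partial>M) = integral\<^sup>L ?P f" by (simp only: GN_law)
  obtain n0 where n0: "\<forall>i. n0 $ i \<noteq> 0" "0 < measure M {\<omega> \<in> space M. 0 < \<bar>f (G \<omega>, n0)\<bar>}"
    using assms(18) by auto
  obtain R where R: "AE \<omega> in M. \<forall>\<^sub>F k in sequentially. norm (?z \<omega> k) \<le> R"
    using minimizer_eventually_bounded[OF M \<mu> \<delta>(1) f f4 B x0 n0(1)
        measure_slice_pos[OF M \<mu> GN f n0(2)] X X_law assms(14)] by blast
  let ?bad = "\<lambda>e n. {\<omega> \<in> space M. norm (?z \<omega> (m n)) \<le> R \<and> e \<le> \<bar>?M \<omega> n - integral\<^sup>L ?P f\<bar>}"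
  obtain C where C: "?bad e n \<in> sets M \<and> measure M (?bad e n) \<le> C / e ^ 4 * (1 / (real n)\<^sup>2)"
    if "1 \<le> n" "1 \<le> m n" "0 < e" for e n
  proof -
    note conclude = that
    show ?thesis
    proof (rule second_stage_tail_bound[OF M \<mu> \<delta>(1) f f4 B x0, of ?X A R], goal_cases)
      case (1 j)
      then show ?case by (rule X)
    next
      case (2 C)
      show ?case
      proof (rule conclude)
        fix e :: real and n assume n: "1 \<le> n" "1 \<le> m n" "0 < e"
        show "?bad e n \<in> sets M \<and> measure M (?bad e n) \<le> C / e ^ 4 * (1 / (real n)\<^sup>2)"
          by (rule 2[OF n(1,3)]) (use second n in blast)
      qed
    qed
  qed

  have "AE \<omega> in M. \<forall>\<^sub>F n in sequentially. \<omega> \<notin> ?bad e n" if e: "0 < e" for e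
  proof -
    have "\<forall>\<^sub>F n in sequentially. 1 \<le> n \<and> 1 \<le> m n"
      using assms(17) by (auto simp: filterlim_at_top intro!: eventually_conj eventually_ge_at_top)
    then obtain n1 where n1: "\<And>n. n1 \<le> n \<Longrightarrow> 1 \<le> n \<and> 1 \<le> m n" by (auto simp: eventually_sequentially)
    \<comment> \<open>the conditional law is given for \<open>1 \<le> n\<close> and \<open>1 \<le> m n\<close> only; \<open>m n\<close> vanishes at most for finitely many \<open>n\<close>\<close>
    define bad where "bad n = (if n1 \<le> n then ?bad e n else {})" for n
    have bad: "bad n \<in> sets M" for n using C[of n e] n1[of n] e by (auto simp: bad_def)
    have "summable (\<lambda>n. C / e ^ 4 * (1 / (real n)\<^sup>2))"
      by (intro summable_mult inverse_power_summable[of 2, where 'a = real, simplified inverse_eq_divide]) auto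
    then have "summable (\<lambda>n. measure M (bad n))"
    proof (rule summable_comparison_test'[where N = n1])
      fix n assume "n1 \<le> n"
      then show "norm (measure M (bad n)) \<le> C / e ^ 4 * (1 / (real n)\<^sup>2)"
        using C[of n e] n1[of n] e by (simp add: bad_def)
    qed
    then have "AE \<omega> in M. \<forall>\<^sub>F n in sequentially. \<omega> \<in> space M - bad n"
      by (intro borel_cantelli_AE1 bad) (auto simp: M.emeasure_eq_measure)
    then show ?thesis
    proof eventually_elim
      case (elim \<omega>)
      then show ?case using eventually_ge_at_top[of n1] by eventually_elim (simp add: bad_def)
    qed
  qed
  then have "AE \<omega> in M. \<forall>i. \<forall>\<^sub>F n in sequentially. \<omega> \<notin> ?bad (1 / real (Suc i)) n"
    by (simp add: AE_all_countable)
  with R AE_space show ?thesis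
  proof eventually_elim
    case (elim \<omega>)
    have bounded: "\<forall>\<^sub>F n in sequentially. norm (?z \<omega> (m n)) \<le> R"
      by (rule eventually_compose_filterlim[OF elim(1) assms(17)])
    show ?case unfolding mean
    proof (rule tendstoI)
      fix e :: real assume "0 < e"
      then obtain i where i: "inverse (real (Suc i)) < e" using reals_Archimedean by blast
      have "\<forall>\<^sub>F n in sequentially. \<omega> \<notin> ?bad (1 / real (Suc i)) n" using elim(3) by blast
      with bounded show "\<forall>\<^sub>F n in sequentially. dist (?M \<omega> n) (integral\<^sup>L ?P f) < e"
      proof eventually_elim
        case (elim n)
        then have "\<bar>?M \<omega> n - integral\<^sup>L ?P f\<bar> < 1 / real (Suc i)"
          using \<open>\<omega> \<in> space M\<close> by auto
        then show ?case using i by (simp add: dist_real_def inverse_eq_divide)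
      qed
    qed
  qed
qed

end
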